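(* Let $\Sigma_1,\ldots,\Sigma_\nu$ be signed graphs, where $\Sigma_i$ has order $n_i$, adjacency matrix $A_i$ and (adjacency) eigenvalues $\lambda_{i1},\ldots,\lambda_{in_i}$. Let $\mathcal{B}\subseteq\{0,1\}^\nu\setminus\{(0,\ldots,0)\}$ be a set such that for every $i\in\{1,\ldots,\nu\}$ there is $\beta\in\mathcal{B}$ with $\beta_i=1$. Let $\Sigma=\mathrm{NEPS}(\Sigma_1,\ldots,\Sigma_\nu;\mathcal{B})$ and $n=n_1\cdots n_\nu$. Then: (1) The adjacency matrix of $\Sigma$ is $$A(\Sigma)=\sum_{\beta\in\mathcal{B}}A_1^{\beta_1}\otimes\cdots\otimes A_\nu^{\beta_\nu}.$$ (2) The eigenvalues of $\Sigma$ (with multiplicity) are $$\lambda_{j_1\cdots j_\nu}=\sum_{\beta\in\mathcal{B}}\lambda_{1j_1}^{\beta_1}\cdots\lambda_{\nu j_\nu}^{\beta_\nu},\qquad 1\le j_1\le n_1,\ \ldots,\ 1\le j_\nu\le n_\nu.$$ (3) The energy $$E(\Sigma)=\sum_{j_1=1}^{n_1}\cdots\sum_{j_\nu=1}^{n_\nu}\Big|\sum_{\beta\in\mathcal{B}}\lambda_{1j_1}^{\beta_1}\cdots\lambda_{\nu j_\nu}^{\beta_\nu}\Big|$$ satisfies $$\frac1n E(\Sigma)\le\sum_{\beta\in\mathcal{B}}\ \prod_{i:\beta_i=1}\frac{1}{n_i}E(\Sigma_i).$$ (4) Equality holds in this inequality when $\mathcal{B}=\{(1,1,\ldots,1)\}$;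 and if every $\Sigma_i$ has at least one edge, equality holds for no other $\mathcal{B}$.
   Context: All graphs are finite (with nonempty vertex set), simple and loop-free. A signed graph $\Sigma=(G,\sigma)$ is a graph $G=(V,E)$ (the underlying graph) with a function $\sigma:E\to\{+1,-1\}$. Its order is $|V|$. Its adjacency matrix $A(\Sigma)$ has $(u,v)$ entry $\sigma(uv)$ if $u,v$ are adjacent and $0$ otherwise. The eigenvalues of $\Sigma$ are those of $A(\Sigma)$; the energy $E(\Sigma)$ is the sum of the absolute values of these eigenvalues. For $\Sigma_i=(V_i,E_i,\sigma_i)$ and $\beta\in\{0,1\}^\nu$, $\beta\ne(0,\ldots,0)$, $\mathrm{NEPS}(\Sigma_1,\ldots,\Sigma_\nu;\beta)$ is the signed graph with vertex set $V_1\times\cdots\times V_\nu$, in which $(u_1,\ldots,u_\nu)$ and $(v_1,\ldots,v_\nu)$ are adjacent iff $u_i=v_i$ whenever $\beta_i=0$ and $u_iv_i\in E_i$ whenever $\beta_i=1$, the sign of this edge being $\prod_{i:\beta_i=1}\sigma_i(u_iv_i)$. For a set $\mathcal{B}$ of such vectors, $\mathrm{NEPS}(\Sigma_1,\ldots,\Sigma_\nu;\mathcal{B})$ is the union over $\beta\in\mathcal{B}$ of the signed graphs $\mathrm{NEPS}(\Sigma_1,\ldots,\Sigma_\nu;\beta)$ on the same vertex set (their edge sets are pairwise disjoint). Conventions: $M^0$ is the identity matrix for every square matrix $M$, and $x^0=1$ for every real $x$. Rows and columns of a Kronecker product $A_1\otimes\cdots\otimes A_\nu$ are indexed by $\nu$-tuples,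 the $(\mathbf{j},\mathbf{k})$ entry being the product of the $(j_i,k_i)$ entries of the factors. *)

theory Defs
  imports
    "HOL-Library.FuncSet"
    "HOL-Library.Multiset"
    "Jordan_Normal_Form.Char_Poly"
begin

text \<open>
  An edge is a two-element set of vertices. The sign function is total on sets of vertices, but only
  its values on edges matter.
\<close>

record 'v sgraph =
  verts :: "'v set"
  edges :: "'v set set"
  esign :: "'v set \<Rightarrow> real"

definition signed_graph :: "'v sgraph \<Rightarrow> bool" where
  "signed_graph \<Sigma> \<longleftrightarrow> finite (verts \<Sigma>) \<and> verts \<Sigma> \<noteq> {} \<and>
     (\<forall>e\<in>edges \<Sigma>. e \<subseteq> verts \<Sigma> \<and> card e = 2) \<and>
     (\<forall>e\<in>edges \<Sigma>. esign \<Sigma> e \<in> {1, - 1})"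

definition sg_order :: "'v sgraph \<Rightarrow> nat" where
  "sg_order \<Sigma> = card (verts \<Sigma>)"

text \<open>
  Matrices are indexed by vertices: \<open>M u v\<close> is the entry in row \<open>u\<close> and column \<open>v\<close>, and only the
  entries with \<open>u\<close>, \<open>v\<close> in the relevant finite index set matter.
\<close>

definition adj_matrix :: "'v sgraph \<Rightarrow> 'v \<Rightarrow> 'v \<Rightarrow> real" where
  "adj_matrix \<Sigma> u v = (if {u, v} \<in> edges \<Sigma> then esign \<Sigma> {u, v} else 0)"

primrec mat_power :: "'v set \<Rightarrow> ('v \<Rightarrow> 'v \<Rightarrow> real) \<Rightarrow> nat \<Rightarrow> 'v \<Rightarrow> 'v \<Rightarrow> real" where
  "mat_power V M 0 = (\<lambda>u v. if u = v then 1 else 0)"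
| "mat_power V M (Suc k) = (\<lambda>u v. \<Sum>w\<in>V. mat_power V M k u w * M w v)"

text \<open>A tuple indexed by \<open>I\<close> is a function; entries outside \<open>I\<close> are irrelevant.\<close>

definition kronecker :: "'i set \<Rightarrow> ('i \<Rightarrow> 'v \<Rightarrow> 'v \<Rightarrow> real) \<Rightarrow> ('i \<Rightarrow> 'v) \<Rightarrow> ('i \<Rightarrow> 'v) \<Rightarrow> real" where
  "kronecker I M u v = (\<Prod>i\<in>I. M i (u i) (v i))"

definition enum_mat :: "'v list \<Rightarrow> ('v \<Rightarrow> 'v \<Rightarrow> 'b) \<Rightarrow> 'b mat" where
  "enum_mat vs M = mat (length vs) (length vs) (\<lambda>(i, j). M (vs ! i) (vs ! j))"

text \<open>
  The eigenvalues of a matrix indexed by the finite set \<open>V\<close>, as a multiset: the roots of the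
  characteristic polynomial with multiplicity. Rows and columns are numbered by some enumeration of
  \<open>V\<close>; by \<open>mat_eigenvalues_enum\<close> below the choice is irrelevant. Only real roots are collected, which
  for the symmetric matrices considered here means all of them (\<open>size_sg_eigenvalues\<close>).
\<close>

definition mat_eigenvalues :: "'v set \<Rightarrow> ('v \<Rightarrow> 'v \<Rightarrow> real) \<Rightarrow> real multiset" where
  "mat_eigenvalues V M =
     proots (char_poly (enum_mat (SOME vs. distinct vs \<and> set vs = V) M))"

definition sg_eigenvalues :: "'v sgraph \<Rightarrow> real multiset" where
  "sg_eigenvalues \<Sigma> = mat_eigenvalues (verts \<Sigma>) (adj_matrix \<Sigma>)"

definition energy :: "'v sgraph \<Rightarrow> real" where
  "energy \<Sigma> = (\<Sum>x\<in>#sg_eigenvalues \<Sigma>. \<bar>x\<bar>)"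

text \<open>
  Tuples of vertices are extensional functions on \<open>{1..\<nu>}\<close>, and so are the vectors \<open>\<beta>\<close>, with values
  in \<open>{0, 1}\<close>. For an edge \<open>e = {u, v}\<close> and an index \<open>i\<close> with \<open>\<beta> i = 1\<close>, the set \<open>(\<lambda>w. w i) ` e\<close>
  is the edge \<open>{u i, v i}\<close> of the \<open>i\<close>-th factor.
\<close>

definition neps_single :: "nat \<Rightarrow> (nat \<Rightarrow> 'v sgraph) \<Rightarrow> (nat \<Rightarrow> nat) \<Rightarrow> (nat \<Rightarrow> 'v) sgraph" where
  "neps_single \<nu> S \<beta> = \<lparr>
     verts = (\<Pi>\<^sub>E i\<in>{1..\<nu>}. verts (S i)),
     edges = {{u, v} | u v.
       u \<in> (\<Pi>\<^sub>E i\<in>{1..\<nu>}. verts (S i)) \<and> v \<in> (\<Pi>\<^sub>E i\<in>{1..\<nu>}. verts (S i)) \<and>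
       (\<forall>i\<in>{1..\<nu>}. (\<beta> i = 0 \<longrightarrow> u i = v i) \<and> (\<beta> i = 1 \<longrightarrow> {u i, v i} \<in> edges (S i)))},
     esign = (\<lambda>e. \<Prod>i\<in>{i\<in>{1..\<nu>}. \<beta> i = 1}. esign (S i) ((\<lambda>w. w i) ` e)) \<rparr>"

text \<open>
  In the union, an edge keeps the sign it has in the unique summand containing it; uniqueness is
  \<open>neps_single_edges_disjoint\<close> below.
\<close>

definition neps :: "nat \<Rightarrow> (nat \<Rightarrow> 'v sgraph) \<Rightarrow> (nat \<Rightarrow> nat) set \<Rightarrow> (nat \<Rightarrow> 'v) sgraph" where
  "neps \<nu> S B = \<lparr>
     verts = (\<Pi>\<^sub>E i\<in>{1..\<nu>}. verts (S i)),
     edges = (\<Union>\<beta>\<in>B. edges (neps_single \<nu> S \<beta>)),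
     esign = (\<lambda>e. esign (neps_single \<nu> S (THE \<beta>. \<beta> \<in> B \<and> e \<in> edges (neps_single \<nu> S \<beta>))) e) \<rparr>"

definition zero_vec01 :: "nat \<Rightarrow> nat \<Rightarrow> nat" where
  "zero_vec01 \<nu> = (\<lambda>i\<in>{1..\<nu>}. 0)"

definition ones_vec01 :: "nat \<Rightarrow> nat \<Rightarrow> nat" where
  "ones_vec01 \<nu> = (\<lambda>i\<in>{1..\<nu>}. 1)"

definition neps_basis :: "nat \<Rightarrow> (nat \<Rightarrow> nat) set \<Rightarrow> bool" where
  "neps_basis \<nu> B \<longleftrightarrow>
     B \<subseteq> ({1..\<nu>} \<rightarrow>\<^sub>E {0, 1}) - {zero_vec01 \<nu>} \<and> (\<forall>i\<in>{1..\<nu>}. \<exists>\<beta>\<in>B. \<beta> i = 1)"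


subsection \<open>The definitions are meaningful\<close>

lemma sum_enum:
  assumes "distinct vs"
  shows "(\<Sum>k = 0..<length vs. g (vs ! k)) = (\<Sum>w\<in>set vs. g w)"
  using sum.reindex_bij_betw[OF bij_betw_nth[OF assms refl refl], of g]
  by (simp add: atLeast0LessThan)

lemma char_poly_enum_mat:
  fixes M :: "'v \<Rightarrow> 'v \<Rightarrow> 'b :: comm_ring_1"
  assumes vs: "distinct vs" and ws: "distinct ws" and eq: "set vs = set ws"
  shows "char_poly (enum_mat vs M) = char_poly (enum_mat ws M)"
proof (rule char_poly_similar)
  define n where "n = length vs"
  have n: "length ws = n"
    using vs ws eq by (metis distinct_card n_def)
  define P where "P xs ys = mat n n (\<lambda>(i, j). if xs ! i = (ys ! j :: 'v) then 1 else (0 :: 'b))"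
    for xs ys
  have sum: "(\<Sum>k = 0..<n. g (xs ! k)) = (\<Sum>w\<in>set vs. g w)" if "xs \<in> {vs, ws}"
    for xs and g :: "'v \<Rightarrow> 'b"
    using that sum_enum[of xs g] vs ws eq n n_def by auto
  have mem: "xs ! i \<in> set vs" if "xs \<in> {vs, ws}" "i < n" for xs i
    using that eq n n_def nth_mem by (metis insert_iff singletonD)
  have PP: "P xs ys * P ys xs = 1\<^sub>m n"
    if xs: "xs \<in> {vs, ws}" and ys: "ys \<in> {vs, ws}" for xs ys
  proof (rule eq_matI)
    fix i j assume "i < dim_row (1\<^sub>m n)" "j < dim_col (1\<^sub>m n)"
    hence ij: "i < n" "j < n" by auto
    have inj: "xs ! i = xs ! j \<longleftrightarrow> i = j"
      using xs ij vs ws n n_def by (auto simp: nth_eq_iff_index_eq)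
    have "(P xs ys * P ys xs) $$ (i, j) = (\<Sum>k = 0..<n.
        (if xs ! i = ys ! k then 1 else 0) * (if ys ! k = xs ! j then 1 else 0))"
      using ij by (simp add: P_def scalar_prod_def)
    also have "\<dots> = (\<Sum>w\<in>set vs. (if xs ! i = w then 1 else 0) * (if w = xs ! j then 1 else 0))"
      by (rule sum[OF ys, where g = "\<lambda>w. (if xs ! i = w then 1 else 0) * (if w = xs ! j then 1 else 0)"])
    also have "\<dots> = (\<Sum>w\<in>set vs. if xs ! i = w then (if w = xs ! j then 1 else 0) else 0)"
      by (rule sum.cong) auto
    also have "\<dots> = (if i = j then 1 else 0)"
      using mem[OF xs ij(1)] inj by simp
    finally show "(P xs ys * P ys xs) $$ (i, j) = 1\<^sub>m n $$ (i, j)"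
      using ij by simp
  qed (auto simp: P_def)
  have A: "P vs ws * enum_mat ws M = mat n n (\<lambda>(i, j). M (vs ! i) (ws ! j))"
  proof (rule eq_matI)
    fix i j assume "i < dim_row (mat n n (\<lambda>(i, j). M (vs ! i) (ws ! j)))"
      "j < dim_col (mat n n (\<lambda>(i, j). M (vs ! i) (ws ! j)))"
    hence ij: "i < n" "j < n" by auto
    have "(P vs ws * enum_mat ws M) $$ (i, j) =
        (\<Sum>k = 0..<n. (if vs ! i = ws ! k then 1 else 0) * M (ws ! k) (ws ! j))"
      using ij n by (simp add: P_def enum_mat_def scalar_prod_def)
    also have "\<dots> = (\<Sum>w\<in>set vs. (if vs ! i = w then 1 else 0) * M w (ws ! j))"
      by (rule sum[where g = "\<lambda>w. (if vs ! i = w then 1 else 0) * M w (ws ! j)"]) simp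
    also have "\<dots> = (\<Sum>w\<in>set vs. if vs ! i = w then M w (ws ! j) else 0)"
      by (rule sum.cong) auto
    also have "\<dots> = M (vs ! i) (ws ! j)"
      using mem[of vs i] ij by simp
    finally show "(P vs ws * enum_mat ws M) $$ (i, j) =
        mat n n (\<lambda>(i, j). M (vs ! i) (ws ! j)) $$ (i, j)"
      using ij by simp
  qed (auto simp: P_def enum_mat_def n)
  have "P vs ws * enum_mat ws M * P ws vs = enum_mat vs M"
    unfolding A
  proof (rule eq_matI)
    fix i j assume "i < dim_row (enum_mat vs M)" "j < dim_col (enum_mat vs M)"
    hence ij: "i < n" "j < n" by (auto simp: enum_mat_def n_def)
    have "(mat n n (\<lambda>(i, j). M (vs ! i) (ws ! j)) * P ws vs) $$ (i, j) =
        (\<Sum>k = 0..<n. M (vs ! i) (ws ! k) * (if ws ! k = vs ! j then 1 else 0))"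
      using ij n by (simp add: P_def scalar_prod_def)
    also have "\<dots> = (\<Sum>w\<in>set vs. M (vs ! i) w * (if w = vs ! j then 1 else 0))"
      by (rule sum[where g = "\<lambda>w. M (vs ! i) w * (if w = vs ! j then 1 else 0)"]) simp
    also have "\<dots> = (\<Sum>w\<in>set vs. if vs ! j = w then M (vs ! i) w else 0)"
      by (rule sum.cong) auto
    also have "\<dots> = M (vs ! i) (vs ! j)"
      using mem[of vs j] ij by simp
    finally show "(mat n n (\<lambda>(i, j). M (vs ! i) (ws ! j)) * P ws vs) $$ (i, j) =
        enum_mat vs M $$ (i, j)"
      using ij by (simp add: enum_mat_def n_def)
  qed (auto simp: P_def enum_mat_def n_def)
  moreover have "{enum_mat vs M, enum_mat ws M, P vs ws, P ws vs} \<subseteq> carrier_mat n n"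
    by (simp add: enum_mat_def P_def n flip: n_def)
  ultimately show "similar_mat (enum_mat vs M) (enum_mat ws M)"
    by (intro similar_matI[where n = n and P = "P vs ws" and Q = "P ws vs"])
       (simp_all add: PP)
qed

lemma mat_eigenvalues_enum:
  assumes "distinct vs" and "set vs = V"
  shows "mat_eigenvalues V M = proots (char_poly (enum_mat vs M))"
proof -
  have "distinct (SOME vs. distinct vs \<and> set vs = V) \<and> set (SOME vs. distinct vs \<and> set vs = V) = V"
    by (rule someI[of "\<lambda>vs. distinct vs \<and> set vs = V" vs]) (use assms in auto)
  hence "char_poly (enum_mat (SOME vs. distinct vs \<and> set vs = V) M) = char_poly (enum_mat vs M)"
    using assms by (intro char_poly_enum_mat) auto
  thus ?thesis
    by (simp only: mat_eigenvalues_def)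
qed

lemma real_symmetric_eigenvalue_real:
  fixes A :: "real mat" and a :: complex
  assumes A: "A \<in> carrier_mat n n" and sym: "\<And>i j. i < n \<Longrightarrow> j < n \<Longrightarrow> A $$ (i, j) = A $$ (j, i)"
    and ev: "eigenvalue (map_mat complex_of_real A) a"
  shows "a \<in> \<real>"
proof -
  let ?C = "map_mat complex_of_real A"
  have C: "?C \<in> carrier_mat n n" using A by simp
  obtain v where v: "v \<in> carrier_vec n" "v \<noteq> 0\<^sub>v n" and Cv: "?C *\<^sub>v v = a \<cdot>\<^sub>v v"
    using ev A unfolding eigenvalue_def eigenvector_def by auto
  define f where "f i = (\<Sum>j = 0..<n. of_real (A $$ (i, j)) * v $ j)" for i
  have f: "f i = a * v $ i" if "i < n" for i
    using arg_cong[OF Cv, of "\<lambda>w. w $ i"] that A v(1) by (simp add: f_def scalar_prod_def)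
  define q where "q = (\<Sum>i = 0..<n. cnj (v $ i) * f i)"
  define N where "N = (\<Sum>i = 0..<n. (cmod (v $ i))\<^sup>2)"
  have "cnj q = (\<Sum>i = 0..<n. \<Sum>j = 0..<n. v $ i * (of_real (A $$ (i, j)) * cnj (v $ j)))"
    by (simp add: q_def f_def sum_distrib_left)
  also have "\<dots> = (\<Sum>j = 0..<n. \<Sum>i = 0..<n. v $ i * (of_real (A $$ (i, j)) * cnj (v $ j)))"
    by (rule sum.swap)
  also have "\<dots> = q"
    unfolding q_def f_def sum_distrib_left
    by (intro sum.cong refl) (simp add: sym)
  finally have q: "cnj q = q" .
  have "q = (\<Sum>i = 0..<n. a * of_real ((cmod (v $ i))\<^sup>2))"
    unfolding q_def complex_norm_square
    by (intro sum.cong refl) (simp add: f mult_ac)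
  hence qN: "q = a * of_real N"
    by (simp add: N_def sum_distrib_left)
  obtain i where i: "i < n" "v $ i \<noteq> 0"
    using v by (metis carrier_vecD eq_vecI index_zero_vec(1) index_zero_vec(2))
  have "N > 0"
    unfolding N_def by (rule sum_pos2[of _ i]) (use i in auto)
  hence "cnj a = a"
    using q unfolding qN by simp
  thus ?thesis
    by (simp add: Reals_cnj_iff)
qed

lemma size_proots_real_symmetric:
  fixes A :: "real mat"
  assumes A: "A \<in> carrier_mat n n" and sym: "\<And>i j. i < n \<Longrightarrow> j < n \<Longrightarrow> A $$ (i, j) = A $$ (j, i)"
  shows "size (proots (char_poly A)) = n"
proof -
  let ?C = "map_mat complex_of_real A"
  have C: "?C \<in> carrier_mat n n" using A by simp
  obtain as where as: "char_poly ?C = (\<Prod>a\<leftarrow>as. [:- a, 1:])" "length as = n"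
    using char_poly_factorized[OF C] by blast
  have "a \<in> \<real>" if "a \<in> set as" for a
  proof (rule real_symmetric_eigenvalue_real[OF A sym])
    have "poly (char_poly ?C) a = 0"
      unfolding as(1) using that by (induction as) auto
    thus "eigenvalue ?C a"
      using eigenvalue_root_char_poly[OF C] by simp
  qed
  hence bs: "map complex_of_real (map Re as) = as"
    by (auto simp: map_idI of_real_Re)
  interpret R: map_poly_inj_comm_ring_hom complex_of_real ..
  have lin: "map_poly complex_of_real (\<Prod>a\<leftarrow>xs. [:- a, 1:]) =
      (\<Prod>a\<leftarrow>map complex_of_real xs. [:- a, 1:])" for xs
    by (induction xs) (simp_all add: R.hom_mult of_real_hom.map_poly_pCons_hom del: mult_pCons_left)
  have "map_poly complex_of_real (char_poly A) = (\<Prod>a\<leftarrow>as. [:- a, 1:])"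
    using as(1) of_real_hom.char_poly_hom[OF A] by metis
  also have "\<dots> = (\<Prod>a\<leftarrow>map complex_of_real (map Re as). [:- a, 1:])"
    by (simp only: bs)
  also have "\<dots> = map_poly complex_of_real (\<Prod>a\<leftarrow>map Re as. [:- a, 1:])"
    by (rule lin[symmetric])
  finally have "char_poly A = (\<Prod>a\<leftarrow>map Re as. [:- a, 1:])"
    by (simp only: R.eq_iff)
  moreover have "size (proots (\<Prod>a\<leftarrow>xs. [:- a, 1 :: real:])) = length xs" for xs
  proof (induction xs)
    case (Cons x xs)
    have "(\<Prod>a\<leftarrow>xs. [:- a, 1:]) \<noteq> 0"
      by (auto simp: prod_list_zero_iff)
    thus ?case using Cons by (simp add: proots_mult del: mult_pCons_left)
  qed simp
  ultimately show ?thesis using as(2) by (metis length_map)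
qed

lemma size_sg_eigenvalues:
  assumes "signed_graph \<Sigma>"
  shows "size (sg_eigenvalues \<Sigma>) = sg_order \<Sigma>"
proof -
  obtain vs where vs: "distinct vs" "set vs = verts \<Sigma>"
    using assms finite_distinct_list unfolding signed_graph_def by metis
  have "size (proots (char_poly (enum_mat vs (adj_matrix \<Sigma>)))) = length vs"
    by (rule size_proots_real_symmetric) (auto simp: enum_mat_def adj_matrix_def insert_commute)
  thus ?thesis
    using vs by (simp add: sg_eigenvalues_def mat_eigenvalues_enum sg_order_def flip: distinct_card)
qed

lemma neps_single_edges_disjoint:
  assumes S: "\<And>i. i \<in> {1..\<nu>} \<Longrightarrow> signed_graph (S i)"
    and \<beta>: "\<beta> \<in> {1..\<nu>} \<rightarrow>\<^sub>E {0, 1}" and \<gamma>: "\<gamma> \<in> {1..\<nu>} \<rightarrow>\<^sub>E {0, 1}"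
    and e: "e \<in> edges (neps_single \<nu> S \<beta>)" "e \<in> edges (neps_single \<nu> S \<gamma>)"
  shows "\<beta> = \<gamma>"
proof -
  have *: "\<delta> i = 1 \<longleftrightarrow> card ((\<lambda>w. w i) ` e) = 2"
    if \<delta>: "\<delta> \<in> {1..\<nu>} \<rightarrow>\<^sub>E {0, 1}" and e: "e \<in> edges (neps_single \<nu> S \<delta>)" and i: "i \<in> {1..\<nu>}"
    for \<delta> i
  proof -
    obtain u v where uv: "e = {u, v}"
      "\<delta> i = 0 \<longrightarrow> u i = v i" "\<delta> i = 1 \<longrightarrow> {u i, v i} \<in> edges (S i)"
      using e i unfolding neps_single_def by auto
    have img: "(\<lambda>w. w i) ` e = {u i, v i}"
      using uv(1) by auto
    have "\<delta> i = 0 \<or> \<delta> i = 1"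
      using PiE_mem[OF \<delta> i] by simp
    thus ?thesis
    proof
      assume "\<delta> i = 0"
      thus ?thesis unfolding img using uv(2) by simp
    next
      assume 1: "\<delta> i = 1"
      hence "card {u i, v i} = 2"
        using S[OF i] uv(3) unfolding signed_graph_def by blast
      thus ?thesis unfolding img using 1 by simp
    qed
  qed
  show ?thesis
  proof (rule PiE_ext[OF \<beta> \<gamma>])
    fix i assume i: "i \<in> {1..\<nu>}"
    have "\<beta> i = 1 \<longleftrightarrow> \<gamma> i = 1"
      using *[OF \<beta> e(1) i] *[OF \<gamma> e(2) i] by simp
    thus "\<beta> i = \<gamma> i"
      using PiE_mem[OF \<beta> i] PiE_mem[OF \<gamma> i] by auto
  qed
qed

lemma signed_graph_neps_single:
  assumes S: "\<And>i. i \<in> {1..\<nu>} \<Longrightarrow> signed_graph (S i)"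
    and \<beta>: "\<beta> \<in> ({1..\<nu>} \<rightarrow>\<^sub>E {0, 1}) - {zero_vec01 \<nu>}"
  shows "signed_graph (neps_single \<nu> S \<beta>)"
proof -
  let ?V = "\<Pi>\<^sub>E i\<in>{1..\<nu>}. verts (S i)"
  have V: "finite ?V" "?V \<noteq> {}"
    using S unfolding signed_graph_def by (auto intro!: finite_PiE simp: PiE_eq_empty_iff)
  obtain k where k: "k \<in> {1..\<nu>}" "\<beta> k = 1"
  proof (cases "\<exists>k\<in>{1..\<nu>}. \<beta> k = 1")
    case True
    thus ?thesis using that by blast
  next
    case False
    hence no: "\<beta> i \<noteq> 1" if "i \<in> {1..\<nu>}" for i
      using that by blast
    have "\<beta> = zero_vec01 \<nu>"
    proof
      fix i
      show "\<beta> i = zero_vec01 \<nu> i"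
      proof (cases "i \<in> {1..\<nu>}")
        case True
        thus ?thesis using PiE_mem[of \<beta> "{1..\<nu>}" "\<lambda>_. {0, 1}" i] \<beta> no[OF True]
          by (auto simp: zero_vec01_def)
      next
        case False
        thus ?thesis using PiE_arb[of \<beta> "{1..\<nu>}" "\<lambda>_. {0, 1}" i] \<beta>
          by (auto simp: zero_vec01_def)
      qed
    qed
    thus ?thesis using \<beta> by simp
  qed
  have "e \<subseteq> ?V \<and> card e = 2 \<and> esign (neps_single \<nu> S \<beta>) e \<in> {1, - 1}"
    if e: "e \<in> edges (neps_single \<nu> S \<beta>)" for e
  proof -
    obtain u v where uv: "e = {u, v}" "u \<in> ?V" "v \<in> ?V"
      "\<And>i. i \<in> {1..\<nu>} \<Longrightarrow> \<beta> i = 1 \<Longrightarrow> {u i, v i} \<in> edges (S i)"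
      using e unfolding neps_single_def by auto
    have "card {u k, v k} = 2"
      using uv(4)[OF k] S[OF k(1)] unfolding signed_graph_def by blast
    hence ne: "u \<noteq> v" by auto
    have "\<bar>esign (neps_single \<nu> S \<beta>) e\<bar> = 1"
      unfolding neps_single_def uv(1) sgraph.simps abs_prod
    proof (rule prod.neutral, intro ballI)
      fix i assume "i \<in> {i \<in> {1..\<nu>}. \<beta> i = 1}"
      hence "esign (S i) {u i, v i} \<in> {1, - 1}"
        using uv(4) S unfolding signed_graph_def by blast
      thus "\<bar>esign (S i) ((\<lambda>w. w i) ` {u, v})\<bar> = 1" by auto
    qed
    hence "esign (neps_single \<nu> S \<beta>) e \<in> {1, - 1}"
      by (auto simp: abs_if split: if_splits)
    thus ?thesis using uv ne by auto
  qed
  moreover have "verts (neps_single \<nu> S \<beta>) = ?V" by (simp add: neps_single_def)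
  ultimately show ?thesis
    using V unfolding signed_graph_def by metis
qed

lemma esign_neps:
  assumes S: "\<And>i. i \<in> {1..\<nu>} \<Longrightarrow> signed_graph (S i)"
    and B: "B \<subseteq> {1..\<nu>} \<rightarrow>\<^sub>E {0, 1}"
    and \<beta>: "\<beta> \<in> B" "e \<in> edges (neps_single \<nu> S \<beta>)"
  shows "esign (neps \<nu> S B) e = esign (neps_single \<nu> S \<beta>) e"
proof -
  have "(THE \<beta>. \<beta> \<in> B \<and> e \<in> edges (neps_single \<nu> S \<beta>)) = \<beta>"
  proof (rule the_equality)
    fix \<gamma> assume "\<gamma> \<in> B \<and> e \<in> edges (neps_single \<nu> S \<gamma>)"
    thus "\<gamma> = \<beta>"
      using B \<beta> by (intro neps_single_edges_disjoint[of \<nu> S \<gamma> \<beta> e] S) (assumption | blast)+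
  qed (use \<beta> in simp)
  thus ?thesis by (simp add: neps_def)
qed

lemma signed_graph_neps:
  assumes S: "\<And>i. i \<in> {1..\<nu>} \<Longrightarrow> signed_graph (S i)"
    and B: "B \<subseteq> ({1..\<nu>} \<rightarrow>\<^sub>E {0, 1}) - {zero_vec01 \<nu>}" and ne: "B \<noteq> {}"
  shows "signed_graph (neps \<nu> S B)"
proof -
  have single: "signed_graph (neps_single \<nu> S \<beta>)" if "\<beta> \<in> B" for \<beta>
  proof (rule signed_graph_neps_single)
    show "\<beta> \<in> ({1..\<nu>} \<rightarrow>\<^sub>E {0, 1}) - {zero_vec01 \<nu>}"
      using B that by (rule subsetD)
  qed (rule S)
  have verts: "verts (neps \<nu> S B) = verts (neps_single \<nu> S \<beta>)" for \<beta>
    by (simp add: neps_def neps_single_def)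
  have edge: "e \<subseteq> verts (neps \<nu> S B) \<and> card e = 2 \<and> esign (neps \<nu> S B) e \<in> {1, - 1}"
    if e: "e \<in> edges (neps \<nu> S B)" for e
  proof -
    obtain \<beta> where \<beta>: "\<beta> \<in> B" "e \<in> edges (neps_single \<nu> S \<beta>)"
      using e by (auto simp: neps_def)
    have "esign (neps \<nu> S B) e = esign (neps_single \<nu> S \<beta>) e"
    proof (rule esign_neps)
      show "B \<subseteq> {1..\<nu>} \<rightarrow>\<^sub>E {0, 1}"
        using B by blast
    qed (rule S \<beta> | assumption)+
    thus ?thesis
      using single[OF \<beta>(1)] \<beta>(2) verts[of \<beta>] unfolding signed_graph_def by metis
  qed
  obtain \<beta> where "\<beta> \<in> B" using ne by blast
  thus ?thesis
    using single[of \<beta>] verts[of \<beta>] edge unfolding signed_graph_def by metis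
qed

end

theory Submission
  imports Defs "Jordan_Normal_Form.Schur_Decomposition"
begin

text \<open>
  Bring every \<open>A\<^sub>i\<close> to triangular form by Schur's theorem. The Kronecker products of the base changes
  bring \<open>\<Sum>\<^sub>\<beta> A\<^sub>1\<^bsup>\<beta>\<^sub>1\<^esup> \<otimes> \<dots> \<otimes> A\<^sub>\<nu>\<^bsup>\<beta>\<^sub>\<nu>\<^esup>\<close> to a form that is triangular for the product order on index tuples,
  and its diagonal gives the eigenvalues. The energy bound is the triangle inequality, since the sum of
  \<open>\<bar>\<lambda>\<^sub>1\<^sub>j\<^sub>1\<bar>\<^bsup>\<beta>\<^sub>1\<^esup> \<dots> \<bar>\<lambda>\<^sub>\<nu>\<^sub>j\<^sub>\<nu>\<bar>\<^bsup>\<beta>\<^sub>\<nu>\<^esup>\<close> over all tuples factorizes. A graph with an edge has eigenvalues of both signs;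
  hence if \<open>\<beta>, \<gamma> \<in> B\<close> differ in coordinate \<open>i\<close>, positive eigenvalues outside \<open>i\<close> and a negative one at \<open>i\<close>
  give two terms of opposite sign, and the triangle inequality is strict.
\<close>

section \<open>Polynomials that split into linear factors\<close>

text \<open>Each listed root splits off one linear factor, and over an integral domain the cofactor
  keeps the remaining roots with their multiplicities, so induction on \<open>es\<close>
  applies.\<close>

lemma prod_linear_factors_dvd:
  fixes p :: "'a :: idom poly"
  assumes "p \<noteq> 0" and "mset es \<subseteq># proots p"
  shows "(\<Prod>e\<leftarrow>es. [:- e, 1:]) dvd p"
  using assms
proof (induction es arbitrary: p)
  case (Cons e es)
  have "e \<in># proots p"
    using set_mset_mono[OF Cons.prems(2)] by simp
  hence "poly p e = 0"
    using Cons.prems(1) by simp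
  then obtain q where q: "p = [:- e, 1:] * q"
    by (auto simp: poly_eq_0_iff_dvd)
  have "q \<noteq> 0"
    using q Cons.prems(1) by auto
  moreover have "proots p = {#e#} + proots q"
    unfolding q by (subst proots_mult) (use \<open>q \<noteq> 0\<close> in auto)
  hence "mset es \<subseteq># proots q"
    using Cons.prems(2) by simp
  ultimately have "(\<Prod>e\<leftarrow>es. [:- e, 1:]) dvd q"
    by (rule Cons.IH)
  thus ?case
    unfolding q list.map prod_list.Cons by (rule mult_dvd_mono[OF dvd_refl])
qed simp

text \<open>The linear factors divide the characteristic polynomial; both are monic of degree
  \<open>n\<close>, so the cofactor is 1. This turns a multiset of \<open>n\<close> roots into the
  factorization that Schur's theorem requires.\<close>

lemma char_poly_eq_prod_linear_factors:
  fixes A :: "'a :: idom mat"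
  assumes A: "A \<in> carrier_mat n n" and roots: "proots (char_poly A) = mset es" and len: "length es = n"
  shows "char_poly A = (\<Prod>e\<leftarrow>es. [:- e, 1:])"
proof -
  have deg: "degree (char_poly A) = n" and lead: "lead_coeff (char_poly A) = 1"
    using degree_monic_char_poly[OF A] by auto
  hence nz: "char_poly A \<noteq> 0"
    by auto
  obtain q where q: "char_poly A = (\<Prod>e\<leftarrow>es. [:- e, 1:]) * q"
    using prod_linear_factors_dvd[OF nz, of es] roots by (metis dvdE subset_mset.order_refl)
  have monic: "lead_coeff (\<Prod>e\<leftarrow>es. [:- e, 1:]) = 1"
    by (rule monic_prod_list) auto
  have "degree (\<Prod>e\<leftarrow>es. [:- e, 1:]) = n"
    using len by (simp add: degree_linear_factors)
  moreover have "degree (char_poly A) = degree (\<Prod>e\<leftarrow>es. [:- e, 1:]) + degree q"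
    unfolding q by (rule degree_mult_eq) (use nz q in auto)
  ultimately have "degree q = 0"
    using deg by simp
  moreover have "lead_coeff q = 1"
    using lead monic unfolding q lead_coeff_mult by simp
  ultimately have "q = 1"
    by (metis degree_eq_zeroE coeff_pCons_0 degree_pCons_0 one_pCons)
  thus ?thesis
    using q by simp
qed

section \<open>Matrices indexed by lists\<close>

text \<open>Schur's theorem speaks of numbered rows and columns, the claims speak of vertices and
  tuples. Rows and columns have separate index lists because a base change leads from vertices to
  eigenvalue indices.\<close>

definition rect :: "'x list \<Rightarrow> 'y list \<Rightarrow> ('x \<Rightarrow> 'y \<Rightarrow> 'b) \<Rightarrow> 'b mat" where
  "rect xs ys f = mat (length xs) (length ys) (\<lambda>(i, j). f (xs ! i) (ys ! j))"

lemma rect_carrier [simp]: "rect xs ys f \<in> carrier_mat (length xs) (length ys)"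
  by (simp add: rect_def)

lemma rect_index [simp]:
  "i < length xs \<Longrightarrow> j < length ys \<Longrightarrow> rect xs ys f $$ (i, j) = f (xs ! i) (ys ! j)"
  by (simp add: rect_def)

lemma rect_dim [simp]: "dim_row (rect xs ys f) = length xs" "dim_col (rect xs ys f) = length ys"
  by (simp_all add: rect_def)

lemma enum_mat_rect: "enum_mat vs M = rect vs vs M"
  by (simp add: enum_mat_def rect_def)

lemma rect_mult:
  fixes f :: "'x \<Rightarrow> 'y \<Rightarrow> 'b :: comm_semiring_0"
  assumes "distinct ys"
  shows "rect xs ys f * rect ys zs g = rect xs zs (\<lambda>x z. \<Sum>y\<in>set ys. f x y * g y z)"
proof (rule eq_matI)
  fix i j assume "i < dim_row (rect xs zs (\<lambda>x z. \<Sum>y\<in>set ys. f x y * g y z))"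
    "j < dim_col (rect xs zs (\<lambda>x z. \<Sum>y\<in>set ys. f x y * g y z))"
  hence ij: "i < length xs" "j < length zs" by auto
  show "(rect xs ys f * rect ys zs g) $$ (i, j) =
      rect xs zs (\<lambda>x z. \<Sum>y\<in>set ys. f x y * g y z) $$ (i, j)"
    using ij sum.reindex_bij_betw[OF bij_betw_nth[OF assms refl refl],
        of "\<lambda>y. f (xs ! i) y * g y (zs ! j)"]
    by (simp add: scalar_prod_def atLeast0LessThan)
qed auto

lemma rect_eq_iff:
  "rect xs ys f = rect xs ys g \<longleftrightarrow> (\<forall>x\<in>set xs. \<forall>y\<in>set ys. f x y = g x y)"
proof
  assume eq: "rect xs ys f = rect xs ys g"
  show "\<forall>x\<in>set xs. \<forall>y\<in>set ys. f x y = g x y"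
  proof (intro ballI)
    fix x y assume "x \<in> set xs" "y \<in> set ys"
    then obtain i j where ij: "i < length xs" "j < length ys" "x = xs ! i" "y = ys ! j"
      by (auto simp: in_set_conv_nth)
    show "f x y = g x y"
      using arg_cong[OF eq, of "\<lambda>A. A $$ (i, j)"] ij by simp
  qed
next
  assume "\<forall>x\<in>set xs. \<forall>y\<in>set ys. f x y = g x y"
  thus "rect xs ys f = rect xs ys g"
    by (intro eq_matI) auto
qed

lemma rect_one:
  assumes "distinct xs"
  shows "rect xs xs (\<lambda>x y. if x = y then 1 else 0) = 1\<^sub>m (length xs)"
  using assms by (intro eq_matI) (auto simp: nth_eq_iff_index_eq)

text \<open>Lets the matrices produced by Schur's theorem be read as functions of vertices and
  eigenvalue indices; \<open>ix\<close> and \<open>iy\<close> recover positions, which distinctness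
  makes unique.\<close>

lemma rect_exhaust:
  assumes A: "A \<in> carrier_mat (length xs) (length ys)" and xs: "distinct xs" and ys: "distinct ys"
  obtains f where "A = rect xs ys f"
proof -
  define ix where "ix x = (THE i. i < length xs \<and> xs ! i = x)" for x
  define iy where "iy y = (THE j. j < length ys \<and> ys ! j = y)" for y
  have "ix (xs ! i) = i" if "i < length xs" for i
    unfolding ix_def using xs that by (intro the_equality) (auto simp: nth_eq_iff_index_eq)
  moreover have "iy (ys ! j) = j" if "j < length ys" for j
    unfolding iy_def using ys that by (intro the_equality) (auto simp: nth_eq_iff_index_eq)
  ultimately have "A = rect xs ys (\<lambda>x y. A $$ (ix x, iy y))"
    using A by (intro eq_matI) auto
  thus ?thesis by (rule that)
qed

section \<open>Triangular forms and eigenvalues\<close>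

text \<open>
  \<open>T = q M p\<close> with \<open>q = p\<^sup>-\<^sup>1\<close>, and \<open>T\<close> is upper triangular for every linear order on \<open>J\<close> along which
  the rank \<open>r\<close> is weakly increasing.
\<close>

definition triangular_form ::
  "'v set \<Rightarrow> ('v \<Rightarrow> 'v \<Rightarrow> real) \<Rightarrow> 'j set \<Rightarrow> ('j \<Rightarrow> nat) \<Rightarrow>
   ('v \<Rightarrow> 'j \<Rightarrow> real) \<Rightarrow> ('j \<Rightarrow> 'v \<Rightarrow> real) \<Rightarrow> ('j \<Rightarrow> 'j \<Rightarrow> real) \<Rightarrow> bool" where
  "triangular_form V M J r p q T \<longleftrightarrow>
     (\<forall>u\<in>V. \<forall>v\<in>V. (\<Sum>j\<in>J. p u j * q j v) = (if u = v then 1 else 0)) \<and>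
     (\<forall>j\<in>J. \<forall>k\<in>J. (\<Sum>v\<in>V. q j v * p v k) = (if j = k then 1 else 0)) \<and>
     (\<forall>j\<in>J. \<forall>k\<in>J. (\<Sum>u\<in>V. \<Sum>v\<in>V. q j u * M u v * p v k) = T j k) \<and>
     (\<forall>j\<in>J. \<forall>k\<in>J. j \<noteq> k \<longrightarrow> \<not> r j < r k \<longrightarrow> T j k = 0)"

text \<open>Matrix multiplication yields the double sum with \<open>v\<close> outside; interchanging
  the sums gives the order used in \<open>triangular_form\<close>.\<close>

lemma rect_conj:
  assumes "distinct vs"
  shows "rect js vs q * rect vs vs M * rect vs ks p =
    rect js ks (\<lambda>j k. \<Sum>u\<in>set vs. \<Sum>v\<in>set vs. q j u * M u v * p v (k :: 'k) :: real)"
proof -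
  have "(\<Sum>v\<in>set vs. (\<Sum>u\<in>set vs. q j u * M u v) * p v k) =
      (\<Sum>u\<in>set vs. \<Sum>v\<in>set vs. q j u * M u v * p v k)" for j k
    unfolding sum_distrib_right by (rule sum.swap)
  thus ?thesis
    using assms by (simp add: rect_mult)
qed

text \<open>Since \<open>n\<close> real roots are given, the characteristic polynomial splits over
  the reals, and Schur's theorem allows the diagonal to be prescribed in the order
  \<open>eig 1\<close>, ..., \<open>eig n\<close>.\<close>

lemma triangular_form_exists:
  fixes M :: "'v \<Rightarrow> 'v \<Rightarrow> real" and eig :: "nat \<Rightarrow> real"
  assumes V: "finite V" and n: "card V = n"
    and eig: "mat_eigenvalues V M = image_mset eig (mset_set {1..n})"
  obtains p q T where "triangular_form V M {1..n} (\<lambda>j. j) p q T"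
    and "\<And>j. j \<in> {1..n} \<Longrightarrow> T j j = eig j"
proof -
  obtain vs where vs: "distinct vs" "set vs = V"
    using V finite_distinct_list by metis
  have len: "length vs = n"
    using vs n by (metis distinct_card)
  \<comment> \<open>Matrix positions start at 0 but eigenvalue indices at 1, so position
    \<open>a\<close> carries the index \<open>Suc a\<close>.\<close>
  define js where "js = [1..<Suc n]"
  have js: "distinct js" "set js = {1..n}" "length js = n" "\<And>a. a < n \<Longrightarrow> js ! a = Suc a"
    by (auto simp: js_def simp del: upt_Suc)
  define A where "A = rect vs vs M"
  have A: "A \<in> carrier_mat n n"
    using rect_carrier[of vs vs M] by (simp add: A_def len)
  have "mset (map eig js) = image_mset eig (mset_set {1..n})"
    using js by (metis mset_map mset_set_set)
  hence "proots (char_poly A) = mset (map eig js)"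
    using eig mat_eigenvalues_enum[OF vs, of M] by (simp add: A_def enum_mat_rect)
  hence cp: "char_poly A = (\<Prod>e\<leftarrow>map eig js. [:- e, 1:])"
    by (intro char_poly_eq_prod_linear_factors[OF A]) (auto simp: js)
  obtain D P Q where schur: "schur_decomposition A (map eig js) = (D, P, Q)"
    by (cases "schur_decomposition A (map eig js)") auto
  have sim: "similar_mat_wit A D P Q" and D: "upper_triangular D" "diag_mat D = map eig js"
    using schur_decomposition[OF A cp schur] by auto
  have carr: "D \<in> carrier_mat n n" "P \<in> carrier_mat n n" "Q \<in> carrier_mat n n"
    and PQ: "P * Q = 1\<^sub>m n" "Q * P = 1\<^sub>m n" and APDQ: "A = P * D * Q"
    using sim A unfolding similar_mat_wit_def by (auto simp: Let_def)
  obtain p where p: "P = rect vs js p"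
    using rect_exhaust[of P vs js] carr(2) vs(1) js(1,3) len by metis
  obtain q where q: "Q = rect js vs q"
    using rect_exhaust[of Q js vs] carr(3) vs(1) js(1,3) len by metis
  obtain T where T: "D = rect js js T"
    using rect_exhaust[of D js js] carr(1) js(1,3) by metis
  have "Q * A * P = Q * P * D * (Q * P)"
    using carr unfolding APDQ by (simp add: assoc_mult_mat[of _ n n _ n _ n])
  hence "Q * A * P = D"
    using carr PQ by simp
  hence QAP: "rect js js (\<lambda>j k. \<Sum>u\<in>V. \<Sum>v\<in>V. q j u * M u v * p v k) = rect js js T"
    using rect_conj[OF vs(1), of js q M js p] vs(2) by (simp add: A_def p q T)
  have pq: "rect vs vs (\<lambda>u v. \<Sum>j\<in>{1..n}. p u j * q j v) = rect vs vs (\<lambda>u v. if u = v then 1 else 0)"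
    using PQ(1) by (simp add: p q rect_mult[OF js(1)] rect_one[OF vs(1)] js(2) len)
  have qp: "rect js js (\<lambda>j k. \<Sum>v\<in>V. q j v * p v k) = rect js js (\<lambda>j k. if j = k then 1 else 0)"
    using PQ(2) by (simp add: p q rect_mult[OF vs(1)] rect_one[OF js(1)] vs(2) js(3))
  have tri: "T j k = 0" if jk: "j \<in> {1..n}" "k \<in> {1..n}" "k < j" for j k
  proof -
    have "D $$ (j - 1, k - 1) = 0"
      using D(1) jk carr(1) by (intro upper_triangularD) auto
    thus ?thesis using jk js T by simp
  qed
  have diag: "T j j = eig j" if j: "j \<in> {1..n}" for j
  proof -
    obtain a where a: "a < n" "j = Suc a"
      using j by (cases j) auto
    have "diag_mat D ! a = eig (js ! a)"
      unfolding D(2) using a js(3) by (intro nth_map) auto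
    thus ?thesis using a js T by (simp add: diag_mat_def)
  qed
  show ?thesis
  proof (rule that)
    show "triangular_form V M {1..n} (\<lambda>j. j) p q T"
      unfolding triangular_form_def
    proof (intro conjI)
      show "\<forall>j\<in>{1..n}. \<forall>k\<in>{1..n}. j \<noteq> k \<longrightarrow> \<not> j < k \<longrightarrow> T j k = 0"
        using tri by auto
    qed (use QAP pq qp in \<open>unfold rect_eq_iff vs(2) js(2)\<close>)
  qed (rule diag)
qed

text \<open>Listing \<open>J\<close> by increasing rank makes \<open>T\<close> an honest upper
  triangular matrix similar to \<open>M\<close>, so its diagonal gives the characteristic
  roots.\<close>

lemma mat_eigenvalues_triangular_form:
  assumes fin: "finite V" "finite J" and card: "card V = card J"
    and tf: "triangular_form V M J r p q T"
  shows "mat_eigenvalues V M = image_mset (\<lambda>j. T j j) (mset_set J)"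
proof -
  obtain vs where vs: "distinct vs" "set vs = V"
    using fin finite_distinct_list by metis
  obtain js0 where js0: "distinct js0" "set js0 = J"
    using fin finite_distinct_list by metis
  define js where "js = sort_key r js0"
  have js: "distinct js" "set js = J" "sorted (map r js)"
    using js0 by (simp_all add: js_def)
  define n where "n = length vs"
  have len: "length vs = n" "length js = n"
    using vs js card by (metis distinct_card n_def)+
  have mset_js: "mset js = mset_set J"
    using js by (metis mset_set_set)
  let ?A = "rect vs vs M" and ?D = "rect js js T" and ?P = "rect vs js p" and ?Q = "rect js vs q"
  have carr: "{?A, ?D, ?P, ?Q} \<subseteq> carrier_mat n n"
    using rect_carrier len by (metis empty_subsetI insert_subset)
  have QAP: "?Q * ?A * ?P = ?D"
    unfolding rect_conj[OF vs(1)] rect_eq_iff using tf vs(2) js(2) by (auto simp: triangular_form_def)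
  have "rect vs vs (\<lambda>u v. \<Sum>j\<in>J. p u j * q j v) = rect vs vs (\<lambda>u v. if u = v then 1 else 0)"
    unfolding rect_eq_iff using tf vs(2) by (auto simp: triangular_form_def)
  hence PQ: "?P * ?Q = 1\<^sub>m n"
    by (simp add: rect_mult[OF js(1)] rect_one[OF vs(1)] js(2) len)
  have "rect js js (\<lambda>j k. \<Sum>v\<in>V. q j v * p v k) = rect js js (\<lambda>j k. if j = k then 1 else 0)"
    unfolding rect_eq_iff using tf js(2) by (auto simp: triangular_form_def)
  hence QP: "?Q * ?P = 1\<^sub>m n"
    by (simp add: rect_mult[OF vs(1)] rect_one[OF js(1)] vs(2) len)
  have "similar_mat ?D ?A"
    using carr by (intro similar_matI[where P = ?Q and Q = ?P and n = n] QAP[symmetric] PQ QP) auto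
  hence "char_poly ?A = char_poly ?D"
    by (rule char_poly_similar[symmetric])
  also have "\<dots> = (\<Prod>a\<leftarrow>diag_mat ?D. [:- a, 1:])"
  proof (rule char_poly_upper_triangular)
    show "?D \<in> carrier_mat n n" using carr by simp
    show "upper_triangular ?D"
      unfolding upper_triangular_def
    proof (intro allI impI)
      fix a b assume "a < dim_row ?D" "b < a"
      hence ab: "a < n" "b < a" by (auto simp: len)
      \<comment> \<open>Below the diagonal the row index has at least the rank of the column index;
        ties do no harm, because \<open>T\<close> vanishes between distinct indices of equal
        rank.\<close>
      hence "r (js ! b) \<le> r (js ! a)"
        using js(3) len sorted_nth_mono[of "map r js" b a] by simp
      moreover have "js ! a \<noteq> js ! b"
        using ab js(1) len by (simp add: nth_eq_iff_index_eq)
      ultimately have "T (js ! a) (js ! b) = 0"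
        using tf ab len nth_mem[of a js] nth_mem[of b js] js(2) by (auto simp: triangular_form_def)
      thus "?D $$ (a, b) = 0" using ab len by simp
    qed
  qed
  also have "diag_mat ?D = map (\<lambda>j. T j j) js"
    by (rule nth_equalityI) (auto simp: diag_mat_def)
  finally have "char_poly ?A = (\<Prod>a\<leftarrow>map (\<lambda>j. T j j) js. [:- a, 1:])" .
  moreover have "proots (\<Prod>a\<leftarrow>xs. [:- a, 1 :: real:]) = mset xs" for xs
  proof (induction xs)
    case (Cons x xs)
    have "(\<Prod>a\<leftarrow>xs. [:- a, 1:]) \<noteq> 0"
      by (auto simp: prod_list_zero_iff)
    thus ?case using Cons by (simp add: proots_mult del: mult_pCons_left)
  qed simp
  ultimately have "proots (char_poly ?A) = mset (map (\<lambda>j. T j j) js)"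
    by (simp only:)
  thus ?thesis
    using mat_eigenvalues_enum[OF vs, of M] mset_js by (simp add: enum_mat_rect)
qed

section \<open>Traces and the signs of eigenvalues\<close>

lemma trace_mult_comm:
  fixes A B :: "'a :: comm_semiring_0 mat"
  assumes "A \<in> carrier_mat n m" "B \<in> carrier_mat m n"
  shows "(\<Sum>i<n. (A * B) $$ (i, i)) = (\<Sum>j<m. (B * A) $$ (j, j))"
proof -
  have "(\<Sum>i<n. (A * B) $$ (i, i)) = (\<Sum>i<n. \<Sum>j<m. A $$ (i, j) * B $$ (j, i))"
    using assms by (simp add: scalar_prod_def atLeast0LessThan)
  also have "\<dots> = (\<Sum>j<m. \<Sum>i<n. B $$ (j, i) * A $$ (i, j))"
    by (subst sum.swap) (simp add: mult.commute)
  also have "\<dots> = (\<Sum>j<m. (B * A) $$ (j, j))"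
    using assms by (simp add: scalar_prod_def atLeast0LessThan)
  finally show ?thesis .
qed

lemma trace_similar_mat_wit:
  fixes A D :: "'a :: comm_ring_1 mat"
  assumes "similar_mat_wit A D P Q" and "A \<in> carrier_mat n n"
  shows "(\<Sum>i<n. A $$ (i, i)) = (\<Sum>i<n. D $$ (i, i))"
proof -
  have carr: "D \<in> carrier_mat n n" "P \<in> carrier_mat n n" "Q \<in> carrier_mat n n"
    and QP: "Q * P = 1\<^sub>m n" and A: "A = P * D * Q"
    using assms unfolding similar_mat_wit_def by (auto simp: Let_def)
  have "(\<Sum>i<n. A $$ (i, i)) = (\<Sum>i<n. (Q * (P * D)) $$ (i, i))"
    unfolding A by (rule trace_mult_comm) (use carr in auto)
  also have "Q * (P * D) = D"
    using carr QP by (simp flip: assoc_mult_mat[of Q n n P n D n])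
  finally show ?thesis .
qed

text \<open>Traces are invariant under similarity, and the Schur form \<open>D\<close> of
  \<open>A\<close> has diagonal \<open>es\<close>, while \<open>D * D\<close> has the squares of
  \<open>es\<close> on its diagonal.\<close>

lemma trace_eq_sum_roots:
  fixes A :: "real mat"
  assumes A: "A \<in> carrier_mat n n" and roots: "proots (char_poly A) = mset es" and len: "length es = n"
  shows "(\<Sum>i<n. A $$ (i, i)) = (\<Sum>e\<leftarrow>es. e)"
    and "(\<Sum>i<n. (A * A) $$ (i, i)) = (\<Sum>e\<leftarrow>es. e\<^sup>2)"
proof -
  have cp: "char_poly A = (\<Prod>e\<leftarrow>es. [:- e, 1:])"
    by (rule char_poly_eq_prod_linear_factors[OF A roots len])
  obtain D P Q where schur: "schur_decomposition A es = (D, P, Q)"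
    by (cases "schur_decomposition A es") auto
  have sim: "similar_mat_wit A D P Q" and ut: "upper_triangular D" and diag: "diag_mat D = es"
    using schur_decomposition[OF A cp schur] by auto
  have D: "D \<in> carrier_mat n n"
    using sim A unfolding similar_mat_wit_def by (auto simp: Let_def)
  have Dii: "D $$ (i, i) = es ! i" if "i < n" for i
    using that D unfolding diag[symmetric] by (simp add: diag_mat_def)
  have "(\<Sum>i<n. A $$ (i, i)) = (\<Sum>i<n. es ! i)"
    using trace_similar_mat_wit[OF sim A] Dii by simp
  thus "(\<Sum>i<n. A $$ (i, i)) = (\<Sum>e\<leftarrow>es. e)"
    by (simp add: sum_list_sum_nth len atLeast0LessThan)
  have "similar_mat_wit (A ^\<^sub>m 2) (D ^\<^sub>m 2) P Q"
    by (rule similar_mat_wit_pow[OF sim])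
  hence "similar_mat_wit (A * A) (D * D) P Q"
    using A D by (simp add: numeral_2_eq_2)
  hence "(\<Sum>i<n. (A * A) $$ (i, i)) = (\<Sum>i<n. (D * D) $$ (i, i))"
    by (rule trace_similar_mat_wit) (use A in auto)
  also have "\<dots> = (\<Sum>i<n. (es ! i)\<^sup>2)"
  proof (intro sum.cong refl)
    fix i assume "i \<in> {..<n}"
    hence i: "i < n" by simp
    have "(D * D) $$ (i, i) = (\<Sum>k\<in>{..<n}. D $$ (i, k) * D $$ (k, i))"
      using i D by (simp add: scalar_prod_def atLeast0LessThan)
    \<comment> \<open>For \<open>k\<close> different from \<open>i\<close>, one of the two factors
      lies below the diagonal of \<open>D\<close>.\<close>
    also have "\<dots> = (\<Sum>k\<in>{..<n}. if k = i then (es ! i)\<^sup>2 else 0)"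
    proof (intro sum.cong refl)
      fix k assume k: "k \<in> {..<n}"
      show "D $$ (i, k) * D $$ (k, i) = (if k = i then (es ! i)\<^sup>2 else 0)"
        using upper_triangularD[OF ut, of k i] upper_triangularD[OF ut, of i k] i k D Dii
        by (cases i k rule: linorder_cases) (auto simp: power2_eq_square)
    qed
    finally show "(D * D) $$ (i, i) = (es ! i)\<^sup>2"
      using i by simp
  qed
  finally show "(\<Sum>i<n. (A * A) $$ (i, i)) = (\<Sum>e\<leftarrow>es. e\<^sup>2)"
    by (simp add: sum_list_sum_nth len atLeast0LessThan)
qed

text \<open>
  The adjacency matrix \<open>A\<close> has trace \<open>0\<close>, while the trace of \<open>A\<^sup>2\<close> is the sum of the squares of its
  entries, hence positive.
\<close>

lemma eigenvalues_of_both_signs: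
  assumes sg: "signed_graph \<Sigma>" and edge: "edges \<Sigma> \<noteq> {}"
    and eig: "sg_eigenvalues \<Sigma> = image_mset eig (mset_set {1..sg_order \<Sigma>})"
  shows "\<exists>j\<in>{1..sg_order \<Sigma>}. eig j > 0" and "\<exists>j\<in>{1..sg_order \<Sigma>}. eig j < 0"
proof -
  define n where "n = sg_order \<Sigma>"
  obtain vs where vs: "distinct vs" "set vs = verts \<Sigma>"
    using sg finite_distinct_list unfolding signed_graph_def by metis
  have len: "length vs = n"
    using vs distinct_card unfolding n_def sg_order_def by metis
  define a where "a = adj_matrix \<Sigma>"
  define A where "A = enum_mat vs a"
  have A: "A \<in> carrier_mat n n"
    by (simp add: A_def enum_mat_def len)
  have Aij: "A $$ (i, j) = a (vs ! i) (vs ! j)" if "i < n" "j < n" for i j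
    using that by (simp add: A_def enum_mat_def len)
  define es where "es = map eig [1..<Suc n]"
  have es: "sum_list (map f es) = (\<Sum>j\<in>{1..n}. f (eig j))" for f :: "real \<Rightarrow> real"
    by (simp add: es_def comp_def sum_list_distinct_conv_sum_set atLeastLessThanSuc_atLeastAtMost
        del: upt_Suc)
  have "mset es = image_mset eig (mset_set {1..n})"
    by (simp add: es_def atLeastLessThanSuc_atLeastAtMost flip: mset_set_upto_eq_mset_upto del: upt_Suc)
  hence roots: "proots (char_poly A) = mset es"
    using eig mat_eigenvalues_enum[OF vs] by (simp add: sg_eigenvalues_def A_def a_def n_def)
  have len_es: "length es = n"
    by (simp add: es_def del: upt_Suc)
  \<comment> \<open>There are no loops: \<open>{u, u}\<close> has one element, an edge has
    two.\<close>
  have a_self: "a u u = 0" for u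
    using sg unfolding a_def adj_matrix_def signed_graph_def by force
  have a_sym: "a u v = a v u" for u v
    by (simp add: a_def adj_matrix_def insert_commute)
  have "(\<Sum>j\<in>{1..n}. eig j) = (\<Sum>i<n. A $$ (i, i))"
    using trace_eq_sum_roots(1)[OF A roots len_es] es[of "\<lambda>x. x"] by simp
  hence sum0: "(\<Sum>j\<in>{1..n}. eig j) = 0"
    by (simp add: Aij a_self)
  have "(\<Sum>j\<in>{1..n}. (eig j)\<^sup>2) = (\<Sum>i<n. (A * A) $$ (i, i))"
    using trace_eq_sum_roots(2)[OF A roots len_es] es[of "\<lambda>x. x\<^sup>2"] by simp
  also have "\<dots> = (\<Sum>i<n. \<Sum>j<n. (A $$ (i, j))\<^sup>2)"
  proof (intro sum.cong refl)
    fix i assume "i \<in> {..<n}"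
    thus "(A * A) $$ (i, i) = (\<Sum>j<n. (A $$ (i, j))\<^sup>2)"
      using A a_sym by (simp add: scalar_prod_def atLeast0LessThan Aij power2_eq_square)
  qed
  also have "\<dots> > 0"
  proof -
    obtain e where e: "e \<in> edges \<Sigma>"
      using edge by blast
    hence esub: "e \<subseteq> verts \<Sigma>" "card e = 2" "esign \<Sigma> e \<in> {1, - 1}"
      using sg unfolding signed_graph_def by blast+
    obtain u v where uv: "e = {u, v}"
      using esub(2) card_2_iff by metis
    obtain i j where ij: "i < n" "j < n" "u = vs ! i" "v = vs ! j"
      using esub(1) uv vs(2) len by (metis insert_subset in_set_conv_nth)
    have "A $$ (i, j) \<noteq> 0"
      using ij e esub(3) by (auto simp: Aij a_def adj_matrix_def uv)
    hence "(\<Sum>j<n. (A $$ (i, j))\<^sup>2) > 0"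
      using ij by (intro sum_pos2[of _ j]) auto
    thus ?thesis
      using ij by (intro sum_pos2[where i = i and f = "\<lambda>i. \<Sum>j<n. (A $$ (i, j))\<^sup>2"]) (auto intro: sum_nonneg)
  qed
  finally have "(\<Sum>j\<in>{1..n}. (eig j)\<^sup>2) > 0" .
  hence ex: "\<exists>j\<in>{1..n}. eig j \<noteq> 0"
    by (metis (no_types, lifting) less_irrefl sum.neutral zero_power2)
  \<comment> \<open>Eigenvalues of one weak sign with sum 0 would all vanish, against
    \<open>ex\<close>; the same argument with signs reversed gives the second claim.\<close>
  show "\<exists>j\<in>{1..sg_order \<Sigma>}. eig j > 0"
  proof (rule ccontr)
    assume "\<not> ?thesis"
    hence "\<forall>j\<in>{1..n}. eig j \<le> 0"
      by (auto simp: n_def not_less)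
    hence "(\<Sum>j\<in>{1..n}. - eig j) = 0 \<longleftrightarrow> (\<forall>j\<in>{1..n}. - eig j = 0)"
      by (intro sum_nonneg_eq_0_iff) auto
    thus False
      using sum0 ex by (simp add: sum_negf)
  qed
  show "\<exists>j\<in>{1..sg_order \<Sigma>}. eig j < 0"
  proof (rule ccontr)
    assume "\<not> ?thesis"
    hence "\<forall>j\<in>{1..n}. eig j \<ge> 0"
      by (auto simp: n_def not_less)
    thus False
      using sum0 ex sum_nonneg_eq_0_iff[of "{1..n}" eig] by auto
  qed
qed

section \<open>The adjacency matrix of a NEPS\<close>

lemma mat_power_1:
  assumes "finite V" "u \<in> V"
  shows "mat_power V M 1 u v = M u v"
proof -
  have "mat_power V M 1 u v = (\<Sum>w\<in>V. if u = w then M w v else 0)"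
    unfolding One_nat_def mat_power.simps by (intro sum.cong) auto
  thus ?thesis
    using assms by simp
qed

text \<open>Exponent 0 contributes an identity entry, which tests \<open>u i = v i\<close>; exponent
  1 contributes the signed adjacency of \<open>u i\<close> and \<open>v i\<close>. The product
  vanishes once a coordinate fails its test, and otherwise it is the product of the signs.\<close>

lemma kronecker_neps_single:
  assumes S: "\<And>i. i \<in> {1..\<nu>} \<Longrightarrow> signed_graph (S i)"
    and \<beta>: "\<beta> \<in> {1..\<nu>} \<rightarrow>\<^sub>E {0, 1}"
    and u: "u \<in> (\<Pi>\<^sub>E i\<in>{1..\<nu>}. verts (S i))" and v: "v \<in> (\<Pi>\<^sub>E i\<in>{1..\<nu>}. verts (S i))"
  shows "kronecker {1..\<nu>} (\<lambda>i. mat_power (verts (S i)) (adj_matrix (S i)) (\<beta> i)) u v =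
    adj_matrix (neps_single \<nu> S \<beta>) u v"
proof -
  define ok where "ok \<longleftrightarrow> (\<forall>i\<in>{1..\<nu>}. (\<beta> i = 0 \<longrightarrow> u i = v i) \<and> (\<beta> i = 1 \<longrightarrow> {u i, v i} \<in> edges (S i)))"
  have edge: "{u, v} \<in> edges (neps_single \<nu> S \<beta>) \<longleftrightarrow> ok"
  proof
    assume "{u, v} \<in> edges (neps_single \<nu> S \<beta>)"
    then obtain u' v' where "{u, v} = {u', v'}" and
      *: "\<forall>i\<in>{1..\<nu>}. (\<beta> i = 0 \<longrightarrow> u' i = v' i) \<and> (\<beta> i = 1 \<longrightarrow> {u' i, v' i} \<in> edges (S i))"
      unfolding neps_single_def sgraph.simps by blast
    \<comment> \<open>Edges are unordered, so the witnesses may be \<open>u\<close> and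
      \<open>v\<close> in either order; the adjacency condition is symmetric.\<close>
    hence "u = u' \<and> v = v' \<or> u = v' \<and> v = u'"
      by (simp add: doubleton_eq_iff)
    thus ok
      using * unfolding ok_def by (elim disjE conjE) (simp_all add: insert_commute)
  next
    assume ok
    thus "{u, v} \<in> edges (neps_single \<nu> S \<beta>)"
      using u v unfolding ok_def neps_single_def sgraph.simps
      by (intro CollectI exI[of _ u] exI[of _ v] conjI refl)
  qed
  have \<beta>01: "\<beta> i = 0 \<or> \<beta> i = 1" if "i \<in> {1..\<nu>}" for i
    using PiE_mem[OF \<beta> that] by simp
  have entry: "mat_power (verts (S i)) (adj_matrix (S i)) (\<beta> i) (u i) (v i) =
      (if \<beta> i = 1 then adj_matrix (S i) (u i) (v i) else if u i = v i then 1 else 0)"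
    if i: "i \<in> {1..\<nu>}" for i
    using \<beta>01[OF i] mat_power_1[of "verts (S i)" "u i"] S[OF i] PiE_mem[OF u i]
    by (auto simp: signed_graph_def)
  show ?thesis
  proof (cases ok)
    case True
    have "kronecker {1..\<nu>} (\<lambda>i. mat_power (verts (S i)) (adj_matrix (S i)) (\<beta> i)) u v =
        (\<Prod>i\<in>{1..\<nu>}. if \<beta> i = 1 then esign (S i) {u i, v i} else 1)"
      unfolding kronecker_def
    proof (intro prod.cong refl)
      fix i assume i: "i \<in> {1..\<nu>}"
      show "mat_power (verts (S i)) (adj_matrix (S i)) (\<beta> i) (u i) (v i) =
          (if \<beta> i = 1 then esign (S i) {u i, v i} else 1)"
        unfolding entry[OF i] using True \<beta>01[OF i] i by (auto simp: ok_def adj_matrix_def)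
    qed
    also have "\<dots> = (\<Prod>i\<in>{i\<in>{1..\<nu>}. \<beta> i = 1}. esign (S i) {u i, v i})"
      by (rule prod.inter_filter[symmetric]) simp
    also have "\<dots> = esign (neps_single \<nu> S \<beta>) {u, v}"
      by (simp add: neps_single_def)
    finally show ?thesis
      using True edge by (simp add: adj_matrix_def)
  next
    case False
    then obtain i where i: "i \<in> {1..\<nu>}"
      "\<not> ((\<beta> i = 0 \<longrightarrow> u i = v i) \<and> (\<beta> i = 1 \<longrightarrow> {u i, v i} \<in> edges (S i)))"
      by (auto simp: ok_def)
    hence "mat_power (verts (S i)) (adj_matrix (S i)) (\<beta> i) (u i) (v i) = 0"
      unfolding entry[OF i(1)] by (auto simp: adj_matrix_def)
    hence "kronecker {1..\<nu>} (\<lambda>i. mat_power (verts (S i)) (adj_matrix (S i)) (\<beta> i)) u v = 0"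
      unfolding kronecker_def using i(1) by (intro prod_zero) auto
    thus ?thesis
      using False edge by (simp add: adj_matrix_def)
  qed
qed

text \<open>The edge sets for different \<open>\<beta>\<close> are disjoint, so at most one summand
  is nonzero, and it carries the sign of the union.\<close>

lemma adj_matrix_neps:
  assumes S: "\<And>i. i \<in> {1..\<nu>} \<Longrightarrow> signed_graph (S i)"
    and B: "B \<subseteq> {1..\<nu>} \<rightarrow>\<^sub>E {0, 1}"
  shows "adj_matrix (neps \<nu> S B) u v = (\<Sum>\<beta>\<in>B. adj_matrix (neps_single \<nu> S \<beta>) u v)"
proof (cases "{u, v} \<in> edges (neps \<nu> S B)")
  case True
  then obtain \<gamma> where \<gamma>: "\<gamma> \<in> B" "{u, v} \<in> edges (neps_single \<nu> S \<gamma>)"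
    by (auto simp: neps_def)
  have "finite B"
    using B by (rule finite_subset) (auto intro: finite_PiE)
  have "(\<Sum>\<beta>\<in>B. adj_matrix (neps_single \<nu> S \<beta>) u v) =
      (\<Sum>\<beta>\<in>B. if \<beta> = \<gamma> then esign (neps_single \<nu> S \<gamma>) {u, v} else 0)"
  proof (intro sum.cong refl)
    fix \<beta> assume \<beta>: "\<beta> \<in> B"
    show "adj_matrix (neps_single \<nu> S \<beta>) u v =
        (if \<beta> = \<gamma> then esign (neps_single \<nu> S \<gamma>) {u, v} else 0)"
    proof (cases "\<beta> = \<gamma>")
      case True
      thus ?thesis using \<gamma>(2) by (simp add: adj_matrix_def)
    next
      case False
      hence "{u, v} \<notin> edges (neps_single \<nu> S \<beta>)"
        using neps_single_edges_disjoint[OF S subsetD[OF B \<beta>] subsetD[OF B \<gamma>(1)] _ \<gamma>(2)] by blast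
      thus ?thesis using False by (simp add: adj_matrix_def)
    qed
  qed
  also have "\<dots> = esign (neps_single \<nu> S \<gamma>) {u, v}"
    using \<gamma>(1) \<open>finite B\<close> by simp
  also have "\<dots> = esign (neps \<nu> S B) {u, v}"
    by (rule esign_neps[OF S B \<gamma>, symmetric])
  finally show ?thesis
    using True by (simp add: adj_matrix_def)
next
  case False
  thus ?thesis
    by (simp add: adj_matrix_def neps_def)
qed

section \<open>Triangular forms of Kronecker products\<close>

text \<open>Distributivity, used for \<open>u\<close> and then for \<open>v\<close>, turns a product
  of sums over the factors into a sum over tuples.\<close>

lemma kronecker_conj:
  fixes q :: "'i \<Rightarrow> 'v \<Rightarrow> real"
  assumes I: "finite I" and V: "\<And>i. i \<in> I \<Longrightarrow> finite (V i)"
  shows "(\<Sum>u\<in>PiE I V. \<Sum>v\<in>PiE I V. (\<Prod>i\<in>I. q i (u i)) * kronecker I M u v * (\<Prod>i\<in>I. p i (v i))) =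
    (\<Prod>i\<in>I. \<Sum>u\<in>V i. \<Sum>v\<in>V i. q i u * M i u v * p i v)"
proof -
  have "(\<Prod>i\<in>I. \<Sum>u\<in>V i. \<Sum>v\<in>V i. q i u * M i u v * p i v) =
      (\<Sum>u\<in>PiE I V. \<Prod>i\<in>I. \<Sum>v\<in>V i. q i (u i) * M i (u i) v * p i v)"
    by (rule prod_sum_PiE[OF I V])
  also have "\<dots> = (\<Sum>u\<in>PiE I V. \<Sum>v\<in>PiE I V. \<Prod>i\<in>I. q i (u i) * M i (u i) (v i) * p i (v i))"
    by (intro sum.cong refl prod_sum_PiE I V)
  finally show ?thesis
    by (simp add: prod.distrib kronecker_def)
qed

text \<open>The Kronecker product of identity matrices is the identity: extensional tuples that
  agree on \<open>I\<close> are equal.\<close>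

lemma prod_delta_PiE:
  assumes "finite I" "j \<in> PiE I J" "k \<in> PiE I J"
  shows "(\<Prod>i\<in>I. if j i = k i then 1 else 0) = (if j = k then 1 else (0 :: real))"
proof (cases "j = k")
  case False
  then obtain i where "i \<in> I" "j i \<noteq> k i"
    using assms PiE_ext by blast
  hence "(\<Prod>i\<in>I. if j i = k i then 1 else (0 :: real)) = 0"
    using assms(1) by (intro prod_zero) auto
  thus ?thesis using False by simp
qed simp

text \<open>The base change is built from \<open>p\<close> and \<open>q\<close> alone and so serves
  all \<open>\<beta>\<close> at once, hence also the sum over \<open>B\<close>. Tuples are ranked by
  the sum of the ranks of their coordinates.\<close>

lemma triangular_form_kronecker:
  fixes M :: "'i \<Rightarrow> 'v \<Rightarrow> 'v \<Rightarrow> real"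
  assumes I: "finite I" and V: "\<And>i. i \<in> I \<Longrightarrow> finite (V i)" and J: "\<And>i. i \<in> I \<Longrightarrow> finite (J i)"
    and tf: "\<And>i. i \<in> I \<Longrightarrow> triangular_form (V i) (M i) (J i) (r i) (p i) (q i) (T i)"
    and B: "B \<subseteq> I \<rightarrow>\<^sub>E {0, 1 :: nat}"
  shows "triangular_form (PiE I V) (\<lambda>u v. \<Sum>\<beta>\<in>B. kronecker I (\<lambda>i. mat_power (V i) (M i) (\<beta> i)) u v)
    (PiE I J) (\<lambda>j. \<Sum>i\<in>I. r i (j i)) (\<lambda>u j. \<Prod>i\<in>I. p i (u i) (j i)) (\<lambda>j u. \<Prod>i\<in>I. q i (j i) (u i))
    (\<lambda>j k. \<Sum>\<beta>\<in>B. \<Prod>i\<in>I. if \<beta> i = 0 then if j i = k i then 1 else 0 else T i (j i) (k i))"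
    (is "triangular_form ?V ?M ?J ?r ?p ?q ?T")
proof -
  have pq: "(\<Sum>k\<in>J i. p i u k * q i k v) = (if u = v then 1 else 0)" if "i \<in> I" "u \<in> V i" "v \<in> V i" for i u v
    using tf[OF that(1)] that unfolding triangular_form_def by blast
  have qp: "(\<Sum>v\<in>V i. q i j v * p i v k) = (if j = k then 1 else 0)" if "i \<in> I" "j \<in> J i" "k \<in> J i" for i j k
    using tf[OF that(1)] that unfolding triangular_form_def by blast
  have T: "(\<Sum>u\<in>V i. \<Sum>v\<in>V i. q i j u * M i u v * p i v k) = T i j k"
    if "i \<in> I" "j \<in> J i" "k \<in> J i" for i j k
    using tf[OF that(1)] that unfolding triangular_form_def by blast
  have tri: "T i j k = 0" if "i \<in> I" "j \<in> J i" "k \<in> J i" "j \<noteq> k" "\<not> r i j < r i k" for i j k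
    using tf[OF that(1)] that unfolding triangular_form_def by blast
  \<comment> \<open>With exponents 0 and 1 only, conjugation yields either the identity or
    \<open>T i\<close>.\<close>
  have power: "(\<Sum>u\<in>V i. \<Sum>v\<in>V i. q i j u * mat_power (V i) (M i) b u v * p i v k) =
      (if b = 0 then if j = k then 1 else 0 else T i j k)"
    if i: "i \<in> I" "j \<in> J i" "k \<in> J i" and b: "b \<in> {0, 1}" for i j k b
  proof (cases "b = 0")
    case True
    have "(\<Sum>u\<in>V i. \<Sum>v\<in>V i. q i j u * mat_power (V i) (M i) b u v * p i v k) =
        (\<Sum>u\<in>V i. \<Sum>v\<in>V i. if u = v then q i j u * p i v k else 0)"
      using True by (intro sum.cong) auto
    thus ?thesis
      using True V[OF i(1)] qp[OF i] by simp
  next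
    case False
    hence "b = 1" using b by simp
    hence "(\<Sum>u\<in>V i. \<Sum>v\<in>V i. q i j u * mat_power (V i) (M i) b u v * p i v k) =
        (\<Sum>u\<in>V i. \<Sum>v\<in>V i. q i j u * M i u v * p i v k)"
      using mat_power_1[OF V[OF i(1)]] by (intro sum.cong) auto
    thus ?thesis
      using False T[OF i] by simp
  qed
  show ?thesis
    unfolding triangular_form_def
  proof (intro conjI ballI impI)
    fix u v assume uv: "u \<in> ?V" "v \<in> ?V"
    have "(\<Sum>j\<in>?J. ?p u j * ?q j v) = (\<Prod>i\<in>I. \<Sum>k\<in>J i. p i (u i) k * q i k (v i))"
      by (simp add: prod_sum_PiE[OF I J] prod.distrib)
    also have "\<dots> = (\<Prod>i\<in>I. if u i = v i then 1 else 0)"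
      using uv by (intro prod.cong refl pq) (auto simp: PiE_mem)
    finally show "(\<Sum>j\<in>?J. ?p u j * ?q j v) = (if u = v then 1 else 0)"
      using prod_delta_PiE[OF I uv] by simp
  next
    fix j k assume jk: "j \<in> ?J" "k \<in> ?J"
    have "(\<Sum>v\<in>?V. ?q j v * ?p v k) = (\<Prod>i\<in>I. \<Sum>v\<in>V i. q i (j i) v * p i v (k i))"
      by (simp add: prod_sum_PiE[OF I V] prod.distrib)
    also have "\<dots> = (\<Prod>i\<in>I. if j i = k i then 1 else 0)"
      using jk by (intro prod.cong refl qp) (auto simp: PiE_mem)
    finally show "(\<Sum>v\<in>?V. ?q j v * ?p v k) = (if j = k then 1 else 0)"
      using prod_delta_PiE[OF I jk] by simp
  next
    fix j k assume jk: "j \<in> ?J" "k \<in> ?J"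
    have "(\<Sum>u\<in>?V. \<Sum>v\<in>?V. ?q j u * ?M u v * ?p v k) =
        (\<Sum>u\<in>?V. \<Sum>v\<in>?V. \<Sum>\<beta>\<in>B. ?q j u * kronecker I (\<lambda>i. mat_power (V i) (M i) (\<beta> i)) u v * ?p v k)"
      by (simp add: sum_distrib_left sum_distrib_right)
    \<comment> \<open>Two interchanges move the sum over \<open>\<beta>\<close> outside, where each
      summand factorizes.\<close>
    also have "\<dots> = (\<Sum>u\<in>?V. \<Sum>\<beta>\<in>B. \<Sum>v\<in>?V. ?q j u * kronecker I (\<lambda>i. mat_power (V i) (M i) (\<beta> i)) u v * ?p v k)"
      by (intro sum.cong refl sum.swap)
    also have "\<dots> = (\<Sum>\<beta>\<in>B. \<Sum>u\<in>?V. \<Sum>v\<in>?V. ?q j u * kronecker I (\<lambda>i. mat_power (V i) (M i) (\<beta> i)) u v * ?p v k)"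
      by (rule sum.swap)
    also have "\<dots> = (\<Sum>\<beta>\<in>B. \<Prod>i\<in>I. \<Sum>u\<in>V i. \<Sum>v\<in>V i.
        q i (j i) u * mat_power (V i) (M i) (\<beta> i) u v * p i v (k i))"
      by (intro sum.cong refl kronecker_conj[OF I V])
    also have "\<dots> = ?T j k"
    proof (intro sum.cong prod.cong refl power)
      fix \<beta> i assume "\<beta> \<in> B" "i \<in> I"
      thus "\<beta> i \<in> {0, 1}" using B PiE_mem by blast
    qed (use jk in \<open>auto simp: PiE_mem\<close>)
    finally show "(\<Sum>u\<in>?V. \<Sum>v\<in>?V. ?q j u * ?M u v * ?p v k) = ?T j k" .
  next
    fix j k assume jk: "j \<in> ?J" "k \<in> ?J" "j \<noteq> k" "\<not> ?r j < ?r k"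
    \<comment> \<open>If the rank rose strictly in every coordinate where \<open>j\<close> and
      \<open>k\<close> differ, the total rank would rise as well. At the coordinate found here, the
      factor of every \<open>\<beta>\<close> is 0: an off-diagonal identity entry or a vanishing
      entry of \<open>T i\<close>.\<close>
    have "\<exists>i\<in>I. j i \<noteq> k i \<and> \<not> r i (j i) < r i (k i)"
    proof (rule ccontr)
      assume no: "\<not> ?thesis"
      hence le: "r i (j i) \<le> r i (k i)" if "i \<in> I" for i
        using that by (metis less_imp_le order_refl)
      obtain i where "i \<in> I" "j i \<noteq> k i"
        using jk PiE_ext by blast
      hence "?r j < ?r k"
        using no le by (intro sum_strict_mono_ex1[OF I]) auto
      thus False using jk by simp
    qed
    then obtain i where i: "i \<in> I" "j i \<noteq> k i" "\<not> r i (j i) < r i (k i)"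
      by blast
    hence "T i (j i) (k i) = 0"
      using jk by (intro tri) (auto simp: PiE_mem)
    thus "?T j k = 0"
      using i I by (intro sum.neutral ballI prod_zero bexI[of _ i]) auto
  qed
qed

section \<open>Spectrum and energy of a NEPS\<close>

text \<open>\<open>X \<beta>\<close> sums \<open>\<bar>\<lambda>\<^sub>1\<^sub>j\<bar>\<^bsup>\<beta>\<^sub>1\<^esup> \<dots>\<close> over all \<open>j\<close>.\<close>

lemma abs_sum_less_sum_abs:
  fixes f :: "'a \<Rightarrow> real"
  assumes "finite B" "x \<in> B" "y \<in> B" "f x < 0" "0 < f y"
  shows "\<bar>\<Sum>b\<in>B. f b\<bar> < (\<Sum>b\<in>B. \<bar>f b\<bar>)"
proof -
  \<comment> \<open>The negative \<open>f x\<close> makes this sum strictly smaller; for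
    \<open>- f\<close> below, the positive \<open>f y\<close> does.\<close>
  have "(\<Sum>b\<in>B. f b) < (\<Sum>b\<in>B. \<bar>f b\<bar>)"
    using assms by (intro sum_strict_mono_ex1) force+
  moreover have "(\<Sum>b\<in>B. - f b) < (\<Sum>b\<in>B. \<bar>f b\<bar>)"
    using assms by (intro sum_strict_mono_ex1) force+
  ultimately show ?thesis
    by (simp add: abs_less_iff sum_negf)
qed

text \<open>Serves to pass from the sum of Kronecker products to the adjacency matrix, which are
  compared only on tuples of vertices.\<close>

lemma triangular_form_cong:
  assumes "triangular_form V M J r p q T" and "\<And>u v. u \<in> V \<Longrightarrow> v \<in> V \<Longrightarrow> M u v = N u v"
  shows "triangular_form V N J r p q T"
proof -
  have "(\<Sum>u\<in>V. \<Sum>v\<in>V. q j u * M u v * p v k) = (\<Sum>u\<in>V. \<Sum>v\<in>V. q j u * N u v * p v k)" for j k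
    using assms(2) by (intro sum.cong) auto
  thus ?thesis
    using assms(1) by (simp add: triangular_form_def)
qed

lemma sg_eigenvalues_neps:
  fixes S :: "nat \<Rightarrow> 'v sgraph" and eig :: "nat \<Rightarrow> nat \<Rightarrow> real"
  assumes S: "\<And>i. i \<in> {1..\<nu>} \<Longrightarrow> signed_graph (S i)"
    and eig: "\<And>i. i \<in> {1..\<nu>} \<Longrightarrow>
      sg_eigenvalues (S i) = image_mset (eig i) (mset_set {1..sg_order (S i)})"
    and B: "B \<subseteq> {1..\<nu>} \<rightarrow>\<^sub>E {0, 1}"
  shows "sg_eigenvalues (neps \<nu> S B) =
    image_mset (\<lambda>j. \<Sum>\<beta>\<in>B. \<Prod>i\<in>{1..\<nu>}. eig i (j i) ^ \<beta> i)
      (mset_set (\<Pi>\<^sub>E i\<in>{1..\<nu>}. {1..sg_order (S i)}))"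
proof -
  let ?I = "{1..\<nu>}" and ?V = "\<lambda>i. verts (S i)" and ?J = "\<lambda>i. {1..sg_order (S i)}"
  have V: "finite (?V i)" if "i \<in> ?I" for i
    using S[OF that] by (simp add: signed_graph_def)
  \<comment> \<open>Packing \<open>p\<close>, \<open>q\<close> and \<open>T\<close> into one triple
    allows a single choice for all \<open>i\<close>.\<close>
  define P where "P i = (\<lambda>(p, q, T). triangular_form (?V i) (adj_matrix (S i)) (?J i) (\<lambda>j. j) p q T \<and>
      (\<forall>j\<in>?J i. T j j = eig i j))" for i
  have "\<exists>x. P i x" if i: "i \<in> ?I" for i
  proof -
    have "mat_eigenvalues (?V i) (adj_matrix (S i)) = image_mset (eig i) (mset_set (?J i))"
      using eig[OF i] by (simp add: sg_eigenvalues_def)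
    then obtain p q T where "triangular_form (?V i) (adj_matrix (S i)) (?J i) (\<lambda>j. j) p q T"
      "\<And>j. j \<in> ?J i \<Longrightarrow> T j j = eig i j"
      using triangular_form_exists[OF V[OF i] sg_order_def[symmetric]] by metis
    hence "P i (p, q, T)"
      by (simp add: P_def)
    thus ?thesis ..
  qed
  then obtain x where x: "\<And>i. i \<in> ?I \<Longrightarrow> P i (x i)"
    by metis
  define p q T where "p i = fst (x i)" and "q i = fst (snd (x i))" and "T i = snd (snd (x i))" for i
  have tf: "triangular_form (?V i) (adj_matrix (S i)) (?J i) (\<lambda>j. j) (p i) (q i) (T i)"
    and diag: "j \<in> ?J i \<Longrightarrow> T i j j = eig i j" if "i \<in> ?I" for i j
    using x[OF that] by (auto simp: P_def p_def q_def T_def case_prod_beta)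
  have "triangular_form (PiE ?I ?V)
      (\<lambda>u v. \<Sum>\<beta>\<in>B. kronecker ?I (\<lambda>i. mat_power (?V i) (adj_matrix (S i)) (\<beta> i)) u v)
      (PiE ?I ?J) (\<lambda>j. \<Sum>i\<in>?I. j i) (\<lambda>u j. \<Prod>i\<in>?I. p i (u i) (j i)) (\<lambda>j u. \<Prod>i\<in>?I. q i (j i) (u i))
      (\<lambda>j k. \<Sum>\<beta>\<in>B. \<Prod>i\<in>?I. if \<beta> i = 0 then if j i = k i then 1 else 0 else T i (j i) (k i))"
    by (rule triangular_form_kronecker[OF _ V _ tf B]) auto
  hence "triangular_form (PiE ?I ?V) (adj_matrix (neps \<nu> S B))
      (PiE ?I ?J) (\<lambda>j. \<Sum>i\<in>?I. j i) (\<lambda>u j. \<Prod>i\<in>?I. p i (u i) (j i)) (\<lambda>j u. \<Prod>i\<in>?I. q i (j i) (u i))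
      (\<lambda>j k. \<Sum>\<beta>\<in>B. \<Prod>i\<in>?I. if \<beta> i = 0 then if j i = k i then 1 else 0 else T i (j i) (k i))"
  proof (rule triangular_form_cong)
    fix u v assume uv: "u \<in> PiE ?I ?V" "v \<in> PiE ?I ?V"
    have "adj_matrix (neps \<nu> S B) u v = (\<Sum>\<beta>\<in>B. adj_matrix (neps_single \<nu> S \<beta>) u v)"
      by (rule adj_matrix_neps[OF S B])
    thus "(\<Sum>\<beta>\<in>B. kronecker ?I (\<lambda>i. mat_power (?V i) (adj_matrix (S i)) (\<beta> i)) u v) =
        adj_matrix (neps \<nu> S B) u v"
      using kronecker_neps_single[OF S _ uv] B by (simp add: subset_iff)
  qed
  hence "mat_eigenvalues (PiE ?I ?V) (adj_matrix (neps \<nu> S B)) =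
      image_mset (\<lambda>j. \<Sum>\<beta>\<in>B. \<Prod>i\<in>?I. if \<beta> i = 0 then if j i = j i then 1 else 0 else T i (j i) (j i))
        (mset_set (PiE ?I ?J))"
    by (rule mat_eigenvalues_triangular_form[rotated 3])
      (auto simp: card_PiE sg_order_def intro!: finite_PiE V)
  \<comment> \<open>On the diagonal, exponent 0 leaves the identity entry 1, which is also
    \<open>x ^ 0\<close> for every \<open>x\<close>, and exponent 1 leaves the eigenvalue.\<close>
  also have "\<dots> = image_mset (\<lambda>j. \<Sum>\<beta>\<in>B. \<Prod>i\<in>?I. eig i (j i) ^ \<beta> i) (mset_set (PiE ?I ?J))"
  proof (intro image_mset_cong sum.cong prod.cong refl)
    fix j \<beta> i assume "j \<in># mset_set (PiE ?I ?J)" "\<beta> \<in> B" and i: "i \<in> ?I"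
    hence "j \<in> PiE ?I ?J" "\<beta> \<in> ?I \<rightarrow>\<^sub>E {0, 1}"
      using subsetD[OF B] by (simp_all add: finite_PiE)
    hence "j i \<in> ?J i" "\<beta> i \<in> {0, 1}"
      using i by (blast dest: PiE_mem)+
    thus "(if \<beta> i = 0 then if j i = j i then 1 else 0 else T i (j i) (j i)) = eig i (j i) ^ \<beta> i"
      using diag[OF i] by auto
  qed
  finally show ?thesis
    by (simp add: sg_eigenvalues_def neps_def)
qed

lemma energy_eq_sum_abs:
  assumes "sg_eigenvalues \<Sigma> = image_mset f (mset_set J)"
  shows "energy \<Sigma> = (\<Sum>j\<in>J. \<bar>f j\<bar>)"
  using assms by (simp add: energy_def sum_unfold_sum_mset multiset.map_comp comp_def)

text \<open>\<open>B\<close> is nonempty because coordinate 1 is covered. If no member had a 0, all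
  would equal \<open>ones_vec01 \<nu>\<close>; where some member has a 0, the covering condition
  supplies another with a 1.\<close>

lemma neps_basis_distinct:
  assumes "\<nu> \<ge> 1" and basis: "neps_basis \<nu> B" and ne: "B \<noteq> {ones_vec01 \<nu>}"
  obtains \<beta> \<gamma> i where "\<beta> \<in> B" "\<gamma> \<in> B" "i \<in> {1..\<nu>}" "\<beta> i = 1" "\<gamma> i = 0"
proof -
  have B: "B \<subseteq> {1..\<nu>} \<rightarrow>\<^sub>E {0, 1}" and ex: "\<And>i. i \<in> {1..\<nu>} \<Longrightarrow> \<exists>\<beta>\<in>B. \<beta> i = 1"
    using basis unfolding neps_basis_def by blast+
  obtain \<beta> where \<beta>: "\<beta> \<in> B"
    using ex[of 1] assms(1) by auto
  have "\<exists>\<gamma>\<in>B. \<exists>i\<in>{1..\<nu>}. \<gamma> i \<noteq> 1"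
  proof (rule ccontr)
    assume "\<not> ?thesis"
    hence all: "\<gamma> i = 1" if "\<gamma> \<in> B" "i \<in> {1..\<nu>}" for \<gamma> i
      using that by blast
    have "\<gamma> = ones_vec01 \<nu>" if "\<gamma> \<in> B" for \<gamma>
      using B that by (intro PiE_ext[of \<gamma> "{1..\<nu>}" "\<lambda>_. {0, 1}"]) (auto simp: ones_vec01_def all)
    thus False
      using ne \<beta> by blast
  qed
  then obtain \<gamma> i where \<gamma>: "\<gamma> \<in> B" "i \<in> {1..\<nu>}" "\<gamma> i \<noteq> 1"
    by blast
  hence "\<gamma> i = 0"
    using B PiE_mem[of \<gamma> "{1..\<nu>}" "\<lambda>_. {0, 1}" i] by auto
  thus ?thesis
    using that \<gamma> ex by blast
qed

theorem theorem3p1: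
  fixes \<nu> :: nat
    and S :: "nat \<Rightarrow> 'v sgraph"
    and eig :: "nat \<Rightarrow> nat \<Rightarrow> real"
    and B :: "(nat \<Rightarrow> nat) set"
  assumes "\<nu> \<ge> 1"
    and "\<And>i. i \<in> {1..\<nu>} \<Longrightarrow> signed_graph (S i)"
    and "\<And>i. i \<in> {1..\<nu>} \<Longrightarrow>
      sg_eigenvalues (S i) = image_mset (eig i) (mset_set {1..sg_order (S i)})"
    and "neps_basis \<nu> B"
  shows
    "(\<forall>u\<in>verts (neps \<nu> S B). \<forall>v\<in>verts (neps \<nu> S B).
        adj_matrix (neps \<nu> S B) u v =
          (\<Sum>\<beta>\<in>B. kronecker {1..\<nu>}
             (\<lambda>i. mat_power (verts (S i)) (adj_matrix (S i)) (\<beta> i)) u v))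
   \<and> sg_eigenvalues (neps \<nu> S B) =
       image_mset (\<lambda>j. \<Sum>\<beta>\<in>B. \<Prod>i\<in>{1..\<nu>}. eig i (j i) ^ \<beta> i)
         (mset_set (\<Pi>\<^sub>E i\<in>{1..\<nu>}. {1..sg_order (S i)}))
   \<and> energy (neps \<nu> S B) =
       (\<Sum>j\<in>(\<Pi>\<^sub>E i\<in>{1..\<nu>}. {1..sg_order (S i)}).
          \<bar>\<Sum>\<beta>\<in>B. \<Prod>i\<in>{1..\<nu>}. eig i (j i) ^ \<beta> i\<bar>)
   \<and> energy (neps \<nu> S B) / real (\<Prod>i\<in>{1..\<nu>}. sg_order (S i)) \<le>
       (\<Sum>\<beta>\<in>B. \<Prod>i\<in>{i\<in>{1..\<nu>}. \<beta> i = 1}. energy (S i) / real (sg_order (S i)))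
   \<and> (B = {ones_vec01 \<nu>} \<longrightarrow>
       energy (neps \<nu> S B) / real (\<Prod>i\<in>{1..\<nu>}. sg_order (S i)) =
       (\<Sum>\<beta>\<in>B. \<Prod>i\<in>{i\<in>{1..\<nu>}. \<beta> i = 1}. energy (S i) / real (sg_order (S i))))
   \<and> ((\<forall>i\<in>{1..\<nu>}. edges (S i) \<noteq> {}) \<and> B \<noteq> {ones_vec01 \<nu>} \<longrightarrow>
       energy (neps \<nu> S B) / real (\<Prod>i\<in>{1..\<nu>}. sg_order (S i)) \<noteq>
       (\<Sum>\<beta>\<in>B. \<Prod>i\<in>{i\<in>{1..\<nu>}. \<beta> i = 1}. energy (S i) / real (sg_order (S i))))"
proof -
  note S = assms(2) and eig = assms(3)
  let ?I = "{1..\<nu>}" and ?J = "\<lambda>i. {1..sg_order (S i)}"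
  have B: "B \<subseteq> ?I \<rightarrow>\<^sub>E {0, 1}"
    using assms(4) unfolding neps_basis_def by blast
  hence fin_B: "finite B"
    by (rule finite_subset) (auto intro: finite_PiE)
  have fin_J: "finite (PiE ?I ?J)"
    by (auto intro: finite_PiE)
  define N where "N = real (\<Prod>i\<in>?I. sg_order (S i))"
  have order_pos: "sg_order (S i) > 0" if "i \<in> ?I" for i
    using S[OF that] by (simp add: sg_order_def signed_graph_def card_gt_0_iff)
  hence N: "N > 0"
    unfolding N_def of_nat_prod by (intro prod_pos) auto
  define t where "t \<beta> j = (\<Prod>i\<in>?I. eig i (j i) ^ \<beta> i)" for \<beta> j :: "nat \<Rightarrow> nat"
  define R where "R = (\<Sum>\<beta>\<in>B. \<Prod>i\<in>{i\<in>?I. \<beta> i = 1}. energy (S i) / real (sg_order (S i)))"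

  have adj: "adj_matrix (neps \<nu> S B) u v =
      (\<Sum>\<beta>\<in>B. kronecker ?I (\<lambda>i. mat_power (verts (S i)) (adj_matrix (S i)) (\<beta> i)) u v)"
    if "u \<in> verts (neps \<nu> S B)" "v \<in> verts (neps \<nu> S B)" for u v
  proof -
    have uv: "u \<in> (\<Pi>\<^sub>E i\<in>?I. verts (S i))" "v \<in> (\<Pi>\<^sub>E i\<in>?I. verts (S i))"
      using that by (simp_all add: neps_def)
    have "adj_matrix (neps \<nu> S B) u v = (\<Sum>\<beta>\<in>B. adj_matrix (neps_single \<nu> S \<beta>) u v)"
      by (rule adj_matrix_neps[OF S B])
    also have "\<dots> = (\<Sum>\<beta>\<in>B. kronecker ?I (\<lambda>i. mat_power (verts (S i)) (adj_matrix (S i)) (\<beta> i)) u v)"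
    proof (intro sum.cong refl)
      fix \<beta> assume "\<beta> \<in> B"
      thus "adj_matrix (neps_single \<nu> S \<beta>) u v =
          kronecker ?I (\<lambda>i. mat_power (verts (S i)) (adj_matrix (S i)) (\<beta> i)) u v"
        by (intro kronecker_neps_single[OF S subsetD[OF B] uv, symmetric])
    qed
    finally show ?thesis .
  qed
  have ev: "sg_eigenvalues (neps \<nu> S B) = image_mset (\<lambda>j. \<Sum>\<beta>\<in>B. t \<beta> j) (mset_set (PiE ?I ?J))"
    unfolding t_def by (rule sg_eigenvalues_neps[OF S eig B])
  have en: "energy (neps \<nu> S B) = (\<Sum>j\<in>PiE ?I ?J. \<bar>\<Sum>\<beta>\<in>B. t \<beta> j\<bar>)"
    by (rule energy_eq_sum_abs[OF ev])

  \<comment> \<open>The sum over tuples factorizes over \<open>i\<close>. A coordinate with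
    \<open>\<beta> i = 0\<close> contributes the order of \<open>S i\<close>, which cancels against
    its factor in \<open>N\<close>.\<close>
  have "(\<Sum>j\<in>PiE ?I ?J. \<bar>t \<beta> j\<bar>) / N = (\<Prod>i\<in>{i\<in>?I. \<beta> i = 1}. energy (S i) / real (sg_order (S i)))"
    if \<beta>: "\<beta> \<in> B" for \<beta>
  proof -
    have "(\<Sum>j\<in>PiE ?I ?J. \<bar>t \<beta> j\<bar>) = (\<Prod>i\<in>?I. \<Sum>k\<in>?J i. \<bar>eig i k\<bar> ^ \<beta> i)"
      by (simp add: t_def abs_prod power_abs prod_sum_PiE)
    hence "(\<Sum>j\<in>PiE ?I ?J. \<bar>t \<beta> j\<bar>) / N =
        (\<Prod>i\<in>?I. (\<Sum>k\<in>?J i. \<bar>eig i k\<bar> ^ \<beta> i) / real (sg_order (S i)))"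
      by (simp add: N_def prod_dividef)
    also have "\<dots> = (\<Prod>i\<in>?I. if \<beta> i = 1 then energy (S i) / real (sg_order (S i)) else 1)"
    proof (intro prod.cong refl)
      fix i assume i: "i \<in> ?I"
      have "\<beta> i \<in> {0, 1}"
        using B \<beta> i by (blast dest: PiE_mem)
      thus "(\<Sum>k\<in>?J i. \<bar>eig i k\<bar> ^ \<beta> i) / real (sg_order (S i)) =
          (if \<beta> i = 1 then energy (S i) / real (sg_order (S i)) else 1)"
        using order_pos[OF i] energy_eq_sum_abs[OF eig[OF i]] by auto
    qed
    also have "\<dots> = (\<Prod>i\<in>{i\<in>?I. \<beta> i = 1}. energy (S i) / real (sg_order (S i)))"
      by (rule prod.inter_filter[symmetric]) simp
    finally show ?thesis .
  qed
  hence "R = (\<Sum>\<beta>\<in>B. (\<Sum>j\<in>PiE ?I ?J. \<bar>t \<beta> j\<bar>) / N)"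
    unfolding R_def by (intro sum.cong) auto
  also have "\<dots> = (\<Sum>j\<in>PiE ?I ?J. \<Sum>\<beta>\<in>B. \<bar>t \<beta> j\<bar>) / N"
    by (subst sum.swap) (simp add: sum_divide_distrib)
  finally have R: "R = (\<Sum>j\<in>PiE ?I ?J. \<Sum>\<beta>\<in>B. \<bar>t \<beta> j\<bar>) / N" .

  have le: "energy (neps \<nu> S B) / N \<le> R"
    unfolding en R using N by (intro divide_right_mono sum_mono sum_abs) auto
  \<comment> \<open>With a single \<open>\<beta>\<close> the inner sums have one term, and the
    triangle inequality loses nothing.\<close>
  have eq: "energy (neps \<nu> S B) / N = R" if "B = {ones_vec01 \<nu>}"
    unfolding en R by (simp add: that)
  have less: "energy (neps \<nu> S B) / N < R"
    if edges: "\<forall>i\<in>?I. edges (S i) \<noteq> {}" and ne: "B \<noteq> {ones_vec01 \<nu>}"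
  proof -
    obtain \<beta> \<gamma> i where \<beta>: "\<beta> \<in> B" "\<beta> i = 1" and \<gamma>: "\<gamma> \<in> B" "\<gamma> i = 0" and i: "i \<in> ?I"
      using neps_basis_distinct[OF assms(1,4) ne] by metis
    have "\<forall>k\<in>?I. \<exists>l\<in>?J k. eig k l > 0"
      using eigenvalues_of_both_signs(1)[OF S _ eig] edges by blast
    then obtain pos where pos: "\<And>k. k \<in> ?I \<Longrightarrow> pos k \<in> ?J k \<and> eig k (pos k) > 0"
      by metis
    obtain neg where neg: "neg \<in> ?J i" "eig i neg < 0"
      using eigenvalues_of_both_signs(2)[OF S[OF i] _ eig[OF i]] edges i by blast
    \<comment> \<open>At \<open>j\<close> the \<open>\<beta>\<close>-term is negative and the \<open>\<gamma>\<close>-term positive.\<close>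
    define j where "j = (\<lambda>k\<in>?I. if k = i then neg else pos k)"
    have j: "j \<in> PiE ?I ?J"
      unfolding j_def using pos neg(1) by (auto intro!: PiE_I split: if_splits)
    \<comment> \<open>Away from \<open>i\<close> only positive eigenvalues are chosen, so the sign
      of \<open>t \<delta> j\<close> is that of \<open>eig i neg ^ \<delta> i\<close>.\<close>
    have rest: "(\<Prod>k\<in>?I - {i}. eig k (j k) ^ \<delta> k) > 0" for \<delta>
      using pos by (intro prod_pos) (auto simp: j_def)
    have split: "t \<delta> j = eig i neg ^ \<delta> i * (\<Prod>k\<in>?I - {i}. eig k (j k) ^ \<delta> k)" for \<delta>
      unfolding t_def using i by (subst prod.remove[of _ i]) (auto simp: j_def)
    have "t \<beta> j < 0"
      unfolding split using \<beta>(2) neg(2) rest[of \<beta>] by (simp add: mult_neg_pos)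
    moreover have "t \<gamma> j > 0"
      unfolding split using \<gamma>(2) rest[of \<gamma>] by simp
    ultimately have "\<bar>\<Sum>\<beta>\<in>B. t \<beta> j\<bar> < (\<Sum>\<beta>\<in>B. \<bar>t \<beta> j\<bar>)"
      by (rule abs_sum_less_sum_abs[OF fin_B \<beta>(1) \<gamma>(1)])
    \<comment> \<open>Strictness at this one tuple makes the whole sum strict.\<close>
    hence "(\<Sum>j\<in>PiE ?I ?J. \<bar>\<Sum>\<beta>\<in>B. t \<beta> j\<bar>) < (\<Sum>j\<in>PiE ?I ?J. \<Sum>\<beta>\<in>B. \<bar>t \<beta> j\<bar>)"
      using j by (intro sum_strict_mono_ex1[OF fin_J] ballI sum_abs) blast
    thus ?thesis
      unfolding en R using N by (rule divide_strict_right_mono)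
  qed
  show ?thesis
    using adj ev en le eq less unfolding t_def N_def R_def by (auto dest: less_imp_neq)
qed

end
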